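(* Let $0<\varepsilon<\pi/2$. Let $f:\mathbb{R}\to\mathbb{R}$ be a continuous $2\pi$-periodic function such that $f(x+\pi)=-f(x)$ and $f(-x)=-f(x)$ for all $x$, $f(x)>0$ for $x\in(0,\pi)$, $f$ is differentiable except possibly at a finite number of points (per period), none of which belongs to $\pi\mathbb{Z}$, and $f'(0)=2/\pi$. Assume additionally that $f''(0)$ and $f''(\pi)$ exist. Then all the eigenvalues $\lambda\in\mathbb{C}$ of the periodic eigenvalue problem associated with the equation $$ i\varepsilon \frac{d}{dx}\left(f(x)\frac{du}{dx}\right)+i\frac{du}{dx}=\lambda u \quad\text{on } (-\pi,\pi) $$ are real.
   Context: The periodic eigenvalue problem: $\mu\in\mathbb{C}$ is an eigenvalue if there is a non-zero solution $u\in L^2(-\pi,\pi)$ of the differential equation with $\lambda=\mu$ satisfying the periodicity condition $u(-\pi)=u(\pi)$. For every $\lambda\in\mathbb{C}$ the equation has, up to scalar multiples, a unique solution in $L^2(-\pi,\pi)$; it is continuous on $[-\pi,\pi]$ (values at $\pm\pi$ are limits) and non-zero at $x=0$, and $\phi(x,\lambda)$ denotes this solution normalized by $\phi(0,\lambda)=1$. Thus $\mu$ is an eigenvalue if and only if $\phi(-\pi,\mu)=\phi(\pi,\mu)$. The equation is singular at $x=-\pi,0,\pi$, where $f$ vanishes; solutions are functions $u$ with $u$ and $fu'$ locally absolutely continuous on $(-\pi,0)\cup(0,\pi)$, $u$ continuous at $0$, satisfying the equation almost everywhere. *)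

theory Defs
  imports "HOL-Analysis.Analysis"
begin

definition absolutely_continuous_on :: "(real \<Rightarrow> 'a::real_normed_vector) \<Rightarrow> real set \<Rightarrow> bool" where
  "absolutely_continuous_on g S \<longleftrightarrow>
     (\<forall>e>0. \<exists>d>0. \<forall>\<D> T. \<D> division_of T \<and> T \<subseteq> S \<and> (\<Sum>K\<in>\<D>. measure lborel K) < d \<longrightarrow>
        (\<Sum>K\<in>\<D>. norm (g (Sup K) - g (Inf K))) < e)"

definition locally_absolutely_continuous_on ::
    "(real \<Rightarrow> 'a::real_normed_vector) \<Rightarrow> real set \<Rightarrow> bool" where
  "locally_absolutely_continuous_on g S \<longleftrightarrow>
     (\<forall>a b. {a..b} \<subseteq> S \<longrightarrow> absolutely_continuous_on g {a..b})"

definition square_integrable_on :: "(real \<Rightarrow> complex) \<Rightarrow> real set \<Rightarrow> bool" where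
  "square_integrable_on u S \<longleftrightarrow>
     u \<in> borel_measurable (lebesgue_on S) \<and> integrable (lebesgue_on S) (\<lambda>x. (cmod (u x))\<^sup>2)"

(* Solutions of i eps (f u')' + i u' = lam u on (-pi, pi), singular at -pi, 0, pi.
   Since u is only required to be locally absolutely continuous, u' is defined almost
   everywhere; v is the locally absolutely continuous representative of f u'. *)
definition ode_solution ::
    "(real \<Rightarrow> real) \<Rightarrow> real \<Rightarrow> complex \<Rightarrow> (real \<Rightarrow> complex) \<Rightarrow> bool" where
  "ode_solution f \<epsilon> lam u \<longleftrightarrow>
     locally_absolutely_continuous_on u ({-pi<..<0} \<union> {0<..<pi}) \<and>
     isCont u 0 \<and>
     (\<exists>v. locally_absolutely_continuous_on v ({-pi<..<0} \<union> {0<..<pi}) \<and>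
        (AE x in lebesgue. x \<in> {-pi<..<0} \<union> {0<..<pi} \<longrightarrow>
          (\<exists>u' v'. (u has_vector_derivative u') (at x) \<and>
                   v x = of_real (f x) * u' \<and>
                   (v has_vector_derivative v') (at x) \<and>
                   \<i> * of_real \<epsilon> * v' + \<i> * u' = lam * u x)))"

(* The values u(-pi) and u(pi) are one-sided limits from inside the interval. *)
definition periodic_eigenvalue :: "(real \<Rightarrow> real) \<Rightarrow> real \<Rightarrow> complex \<Rightarrow> bool" where
  "periodic_eigenvalue f \<epsilon> \<mu> \<longleftrightarrow>
     (\<exists>u. ode_solution f \<epsilon> \<mu> u \<and>
          square_integrable_on u {-pi<..<pi} \<and>
          (\<exists>x\<in>{-pi<..<pi}. u x \<noteq> 0) \<and>
          (\<exists>l. (u \<longlongrightarrow> l) (at_right (-pi)) \<and> (u \<longlongrightarrow> l) (at_left pi)))"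

end

theory Submission
  imports Defs "HOL-Complex_Analysis.Complex_Analysis"
begin

text \<open>
  On \<open>(0, \<pi>)\<close> put \<open>z = - \<i> \<lambda>\<close>; the equation becomes \<open>\<epsilon> (f y')' + y' = z y\<close>, and \<open>x \<mapsto> u (- x)\<close> solves it
  with \<open>- z\<close> in place of \<open>z\<close>. The solution continuous at \<open>0\<close> is unique up to a factor and is a power
  series in \<open>z\<close>; with \<open>G z\<close> its limit at \<open>\<pi>\<close> when normalized at \<open>0\<close>, the periodicity condition is
  \<open>G z = G (- z)\<close>. The entire function \<open>G\<close> is real on the real axis, has order less than one, and satisfies
  \<open>1 \<le> \<bar>G z\<bar>\<close> for \<open>0 \<le> Re z\<close> by an energy estimate. Hence \<open>G (- z) / G z\<close> is holomorphic in the
  right half-plane and unimodular on the imaginary axis, so by Phragmen--Lindelof and the maximum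
  principle it has modulus less than one in the open half-plane, which forces \<open>Re z = 0\<close>.
\<close>

subsection \<open>Absolutely continuous functions\<close>

text \<open>The half-plane principle fails at order one: \<open>exp z\<close> is unimodular on the
  imaginary axis and unbounded to the right. Estimating the coefficients of the power series by
  \<open>(M * pi) ^ n / fact n\<close> gives only exponential type, so a finer growth estimate, with
  exponent \<open>3/4\<close>, is required. As the coefficients are nonnegative, it is enough to
  prove it for real \<open>z \<ge> 0\<close>.

  The condition \<open>\<epsilon> < pi / 2\<close> enters through the behaviour at
  \<open>pi\<close>. There \<open>f x\<close> is asymptotic to \<open>(2 / pi) * (pi - x)\<close>,
  and the integrating factor \<open>P\<close> grows roughly like the power
  \<open>- pi / (2 * \<epsilon>)\<close> of \<open>pi - x\<close>. This exponent being below
  \<open>-1\<close> makes the primitive \<open>R\<close> at most a multiple of \<open>P * f\<close>.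
  That single inequality gives convergence of the iterated integrals up to \<open>pi\<close>,
  absorbs the truncation errors in the energy estimate, and is used again for growth and
  uniqueness.\<close>

lemma has_integral_derivative_absolutely_continuous:
  fixes g :: "real \<Rightarrow> 'a::euclidean_space"
  assumes ab: "a \<le> b" and ac: "absolutely_continuous_on g {a..b}" and N: "negligible N"
    and der: "\<And>x. x \<in> {a..b} - N \<Longrightarrow> (g has_vector_derivative k x) (at x)"
  shows "(k has_integral (g b - g a)) {a..b}"
proof -
  define h where "h x = (if x \<in> N then 0 else k x)" for x
  \<comment> \<open>The gauge integral is used directly, since nothing is assumed about
    measurability or integrability of \<open>k\<close>. Tags off \<open>N\<close> are handled by
    differentiability, tags in \<open>N\<close> by absolute continuity; the value 0 of
    \<open>h\<close> on \<open>N\<close> removes the latter from the Riemann sum.\<close>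
  have "(h has_integral (g b - g a)) {a..b}"
    unfolding has_integral_real
  proof (intro allI impI)
    fix e :: real assume "e > 0"
    \<comment> \<open>The \<open>+ 1\<close> avoids a division by zero when
      \<open>a = b\<close>.\<close>
    define e' where "e' = e / (2 * (b - a + 1))"
    have e': "e' > 0" "e' * (b - a) \<le> e / 2"
      using \<open>e > 0\<close> ab by (auto simp: e'_def field_simps)
    obtain d where d: "d > 0" and dd: "\<And>\<D> T. \<D> division_of T \<Longrightarrow> T \<subseteq> {a..b} \<Longrightarrow>
        (\<Sum>K\<in>\<D>. measure lborel K) < d \<Longrightarrow> (\<Sum>K\<in>\<D>. norm (g (Sup K) - g (Inf K))) < e / 2"
      using ac[unfolded absolutely_continuous_on_def, rule_format, of "e/2"] \<open>e > 0\<close>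
      by (meson half_gt_zero)
    have Ns: "N \<in> sets lebesgue" "N \<in> null_sets lebesgue"
      using N by (auto simp: negligible_iff_null_sets)
    obtain T where T: "open T" "N \<subseteq> T" "T - N \<in> lmeasurable" "emeasure lebesgue (T - N) < ennreal d"
      using sets_lebesgue_outer_open[OF Ns(1) d] by blast
    have TU: "T = (T - N) \<union> N" using T(2) by auto
    have Tm: "T \<in> lmeasurable"
      using T(3) N negligible_imp_measurable TU by (metis fmeasurable.Un)
    have "emeasure lebesgue T = emeasure lebesgue (T - N)"
      by (subst TU, rule emeasure_Un_null_set) (use T(3) Ns in \<open>auto simp: fmeasurableD\<close>)
    then have "ennreal (measure lebesgue T) < ennreal d"
      using T(4) emeasure_eq_measure2[OF Tm] by (simp del: ennreal_less_iff)
    then have Tmes: "measure lebesgue T < d"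
      by (simp add: ennreal_less_iff)
    have "\<exists>\<delta>>0. x \<in> {a..b} - N \<longrightarrow> (\<forall>y. \<bar>y - x\<bar> < \<delta> \<longrightarrow> norm (g y - g x - (y - x) *\<^sub>R k x) \<le> e' * \<bar>y - x\<bar>)" for x
    proof (cases "x \<in> {a..b} - N")
      case True
      have "(g has_derivative (\<lambda>t. t *\<^sub>R k x)) (at x)"
        using der[OF True] by (simp add: has_vector_derivative_def)
      then show ?thesis
        unfolding has_derivative_at_alt using e'(1) by (auto simp: real_norm_def)
    qed (auto intro: exI[of _ 1])
    then obtain \<delta> where \<delta>: "\<And>x. \<delta> x > 0"
      and \<delta>': "\<And>x y. x \<in> {a..b} - N \<Longrightarrow> \<bar>y - x\<bar> < \<delta> x \<Longrightarrow> norm (g y - g x - (y - x) *\<^sub>R k x) \<le> e' * \<bar>y - x\<bar>"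
      by metis
    \<comment> \<open>Intervals tagged in \<open>N\<close> must lie in the open set \<open>T\<close>
      of measure below \<open>d\<close>, so their total length is below \<open>d\<close> and
      absolute continuity bounds the increments of \<open>g\<close> over them.\<close>
    define \<gamma> where "\<gamma> x = (if x \<in> N then T else ball x (\<delta> x))" for x
    have g\<gamma>: "gauge \<gamma>"
      using T(1,2) \<delta> by (auto simp: gauge_def \<gamma>_def)
    have main: "norm ((\<Sum>(x,K)\<in>p. measure lborel K *\<^sub>R h x) - (g b - g a)) < e"
      if p: "p tagged_division_of {a..b}" and fine: "\<gamma> fine p" for p
    proof -
      let ?D = "\<lambda>K. g (Sup K) - g (Inf K)"
      define p1 where "p1 = {(x,K) \<in> p. x \<in> N}"
      define p2 where "p2 = {(x,K) \<in> p. x \<notin> N}"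
      note pD = tagged_division_ofD[OF p]
      have fin: "finite p" "finite p1" "finite p2"
        using pD(1) by (auto simp: p1_def p2_def intro: finite_subset)
      have pU: "p = p1 \<union> p2" "p1 \<inter> p2 = {}" by (auto simp: p1_def p2_def)
      have "(\<Sum>(x,K)\<in>p. measure lborel K *\<^sub>R h x) - (g b - g a) = (\<Sum>(x,K)\<in>p. measure lborel K *\<^sub>R h x - ?D K)"
        unfolding additive_tagged_division_1[OF ab p, of g, symmetric]
        by (simp add: sum_subtractf case_prod_beta)
      also have "\<dots> = (\<Sum>(x,K)\<in>p1. measure lborel K *\<^sub>R h x - ?D K) + (\<Sum>(x,K)\<in>p2. measure lborel K *\<^sub>R h x - ?D K)"
        by (subst pU(1), rule sum.union_disjoint[OF fin(2,3) pU(2)])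
      finally have eq: "(\<Sum>(x,K)\<in>p. measure lborel K *\<^sub>R h x) - (g b - g a) =
        (\<Sum>(x,K)\<in>p1. measure lborel K *\<^sub>R h x - ?D K) + (\<Sum>(x,K)\<in>p2. measure lborel K *\<^sub>R h x - ?D K)" .
      have p1part: "p1 tagged_partial_division_of {a..b}"
        using p tagged_partial_division_subset[of p "{a..b}" p1] pU by (auto simp: tagged_division_of_def)
      note dv = partial_division_of_tagged_division[OF p1part]
      have sub: "\<Union>(snd ` p1) \<subseteq> {a..b}" "\<Union>(snd ` p1) \<subseteq> T"
      proof -
        have "K \<subseteq> T" if "(x,K) \<in> p1" for x K
          using that fineD[OF fine, of x K] by (auto simp: \<gamma>_def p1_def)
        then show "\<Union>(snd ` p1) \<subseteq> T" by fastforce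
        show "\<Union>(snd ` p1) \<subseteq> {a..b}"
          using tagged_partial_division_ofD(3)[OF p1part] by fastforce
      qed
      have "(\<Sum>K\<in>snd ` p1. measure lborel K) = measure lebesgue (\<Union>(snd ` p1))"
        unfolding content_division[OF dv, symmetric]
      proof (rule sum.cong[OF refl])
        fix K assume "K \<in> snd ` p1"
        then obtain u v where "K = cbox u v" using division_ofD(4)[OF dv] by meson
        then show "measure lborel K = measure lebesgue K" by (simp add: measure_completion)
      qed
      also have "\<dots> \<le> measure lebesgue T"
        using sub(2) Tm lmeasurable_division[OF dv] by (intro measure_mono_fmeasurable) (auto simp: fmeasurableD)
      finally have s1: "(\<Sum>K\<in>snd ` p1. norm (?D K)) < e / 2"
        using Tmes by (intro dd[OF dv sub(1)]) auto
      \<comment> \<open>The value 0 at the empty set matters: the reindexing rule asks for 0 on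
        every box with empty interior, and \<open>Sup {}\<close> and \<open>Inf {}\<close> are
        unspecified.\<close>
      let ?d = "\<lambda>K. if K = {} then 0 else norm (?D K)"
      have ne: "K \<noteq> {}" if "(x,K) \<in> p1" for x K
        using that pD(2)[of x K] by (auto simp: p1_def)
      have "(\<Sum>(x,K)\<in>p1. norm (?D K)) = (\<Sum>(x,K)\<in>p1. ?d K)"
        using ne by (intro sum.cong) auto
      also have "\<dots> = (\<Sum>K\<in>snd ` p1. ?d K)"
      proof (rule sum.over_tagged_division_lemma[OF tagged_partial_division_of_Union_self[OF p1part]])
        fix u v :: real assume "box u v = {}"
        then have "v \<le> u" by simp
        then show "?d (cbox u v) = 0" by (cases "u = v") auto
      qed
      also have "\<dots> = (\<Sum>K\<in>snd ` p1. norm (?D K))"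
        using ne by (intro sum.cong) auto
      finally have b1: "(\<Sum>(x,K)\<in>p1. norm (?D K)) < e / 2" using s1 by simp
      have "norm (\<Sum>(x,K)\<in>p1. measure lborel K *\<^sub>R h x - ?D K) \<le> (\<Sum>(x,K)\<in>p1. norm (?D K))"
        by (rule sum_norm_le) (auto simp: p1_def h_def norm_minus_commute)
      then have n1: "norm (\<Sum>(x,K)\<in>p1. measure lborel K *\<^sub>R h x - ?D K) < e / 2" using b1 by linarith
      have "norm (\<Sum>(x,K)\<in>p2. measure lborel K *\<^sub>R h x - ?D K) \<le> (\<Sum>(x,K)\<in>p2. e' * measure lborel K)"
      proof (rule sum_norm_le, clarify)
        fix x K assume xK: "(x,K) \<in> p2"
        then have xKp: "(x,K) \<in> p" and xN: "x \<notin> N" by (auto simp: p2_def)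
        obtain u v where K: "K = {u..v}" using pD(4)[OF xKp] by auto
        have xin: "x \<in> {u..v}" "x \<in> {a..b}" using pD(2,3)[OF xKp] K by auto
        then have uv: "u \<le> v" by simp
        have "K \<subseteq> ball x (\<delta> x)" using fineD[OF fine xKp] xN by (simp add: \<gamma>_def)
        then have "\<bar>u - x\<bar> < \<delta> x" "\<bar>v - x\<bar> < \<delta> x" using K uv by (auto simp: subset_iff dist_real_def abs_minus_commute)
        then have "norm (g u - g x - (u - x) *\<^sub>R k x) \<le> e' * (x - u)"
          "norm (g v - g x - (v - x) *\<^sub>R k x) \<le> e' * (v - x)"
          using \<delta>'[of x u] \<delta>'[of x v] xN xin by auto
        \<comment> \<open>Splitting the increment at the tag \<open>x\<close> lets the derivative
          bound act on both sides of it; the two errors add up to \<open>e'\<close> times the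
          length.\<close>
        moreover have "measure lborel K *\<^sub>R h x - ?D K = (g u - g x - (u - x) *\<^sub>R k x) - (g v - g x - (v - x) *\<^sub>R k x)"
          using uv xN K by (simp add: h_def algebra_simps)
        ultimately have "norm (measure lborel K *\<^sub>R h x - ?D K) \<le> e' * (x - u) + e' * (v - x)"
          by (smt (verit) norm_triangle_ineq4)
        also have "\<dots> = e' * measure lborel K" using uv K by (simp add: algebra_simps)
        finally show "norm (measure lborel K *\<^sub>R h x - ?D K) \<le> e' * measure lborel K" .
      qed
      also have "\<dots> \<le> (\<Sum>(x,K)\<in>p. e' * measure lborel K)"
        using e' fin pU by (intro sum_mono2) (auto simp: case_prod_beta)
      also have "\<dots> = e' * (\<Sum>(x,K)\<in>p. measure lborel K)"
        by (simp add: sum_distrib_left case_prod_beta)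
      also have "\<dots> = e' * (b - a)"
        using additive_content_tagged_division[of p a b] p ab by simp
      finally have n2: "norm (\<Sum>(x,K)\<in>p2. measure lborel K *\<^sub>R h x - ?D K) \<le> e / 2" using e'(2) by linarith
      show ?thesis unfolding eq using n1 n2 by (smt (verit) norm_triangle_ineq field_sum_of_halves)
    qed
    show "\<exists>\<gamma>. gauge \<gamma> \<and> (\<forall>p. p tagged_division_of {a..b} \<and> \<gamma> fine p \<longrightarrow>
        norm ((\<Sum>(x,K)\<in>p. measure lborel K *\<^sub>R h x) - (g b - g a)) < e)"
      using main by (intro exI[of _ \<gamma>] conjI g\<gamma>) auto
  qed
  then show ?thesis
    by (rule has_integral_spike[OF N, rotated]) (auto simp: h_def)
qed

text \<open>The preceding lemma presents \<open>g\<close> locally as a constant plus an integral of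
  the continuous \<open>k\<close>, so the exceptional set disappears. This turns an equation valid
  almost everywhere into a classical one.\<close>

lemma has_vector_derivative_locally_absolutely_continuous:
  fixes g :: "real \<Rightarrow> 'a::euclidean_space"
  assumes ac: "locally_absolutely_continuous_on g S" and S: "open S"
    and k: "continuous_on S k" and N: "negligible N"
    and der: "\<And>x. x \<in> S - N \<Longrightarrow> (g has_vector_derivative k x) (at x)"
    and x: "x \<in> S"
  shows "(g has_vector_derivative k x) (at x)"
proof -
  obtain d where d: "d > 0" "cball x d \<subseteq> S" using S x open_contains_cball by blast
  define a b where "a = x - d" and "b = x + d"
  have ab: "{a..b} \<subseteq> S" "x \<in> {a<..<b}" using d by (auto simp: a_def b_def cball_eq_atLeastAtMost)
  have kc: "continuous_on {a..b} k" using k ab continuous_on_subset by blast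
  have gi: "integral {a..y} k = g y - g a" if "y \<in> {a..b}" for y
  proof (rule integral_unique, rule has_integral_derivative_absolutely_continuous[OF _ _ N])
    show "absolutely_continuous_on g {a..y}"
      using ac ab that unfolding locally_absolutely_continuous_on_def by (meson atLeastatMost_subset_iff atLeastAtMost_iff order_refl order_trans)
  qed (use that ab der in \<open>auto simp: subset_eq\<close>)
  have "((\<lambda>y. g a + integral {a..y} k) has_vector_derivative k x) (at x within {a..b})"
    using integral_has_vector_derivative[OF kc, of x] ab by (auto intro!: derivative_eq_intros)
  then have "((\<lambda>y. g a + integral {a..y} k) has_vector_derivative k x) (at x)"
    using at_within_interior[of x "{a..b}"] ab by simp
  then show ?thesis
    by (rule has_vector_derivative_transform_within_open[of _ _ _ "{a<..<b}"]) (use ab gi in auto)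
qed

lemma locally_absolutely_continuous_imp_continuous_on:
  assumes ac: "locally_absolutely_continuous_on g S" and S: "open S"
  shows "continuous_on S g"
proof -
  have "isCont g x" if x: "x \<in> S" for x
    unfolding continuous_at_eps_delta
  proof (intro allI impI)
    fix e :: real assume "e > 0"
    obtain r where r: "r > 0" "cball x r \<subseteq> S" using S x open_contains_cball by blast
    then have "absolutely_continuous_on g {x-r..x+r}"
      using ac by (auto simp: locally_absolutely_continuous_on_def cball_eq_atLeastAtMost)
    then obtain d where d: "d > 0" and dd: "\<And>\<D> T. \<D> division_of T \<Longrightarrow> T \<subseteq> {x-r..x+r} \<Longrightarrow>
        (\<Sum>K\<in>\<D>. measure lborel K) < d \<Longrightarrow> (\<Sum>K\<in>\<D>. norm (g (Sup K) - g (Inf K))) < e"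
      using \<open>e > 0\<close> unfolding absolutely_continuous_on_def by meson
    show "\<exists>d>0. \<forall>x'. dist x' x < d \<longrightarrow> dist (g x') (g x) < e"
    proof (intro exI[of _ "min d r"] conjI allI impI)
      fix y assume y: "dist y x < min d r"
      define u v where "u = min x y" and "v = max x y"
      have uv: "u \<le> v" "{u..v} \<subseteq> {x-r..x+r}" "v - u < d"
        using y by (auto simp: u_def v_def dist_real_def)
      have "norm (g v - g u) < e"
        using dd[of "{{u..v}}" "{u..v}"] uv by (simp add: division_of_self[of u v, unfolded cbox_interval])
      then show "dist (g y) (g x) < e"
        by (auto simp: u_def v_def dist_norm norm_minus_commute min_def max_def split: if_splits)
    qed (use d r in auto)
  qed
  then show ?thesis by (simp add: continuous_at_imp_continuous_on)
qed

subsection \<open>Phragmen--Lindelof in a half-plane\<close>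

text \<open>The real part is \<open>norm w powr s * cos (s * Arg w)\<close>, and
  \<open>Arg w\<close> lies within \<open>pi / 2\<close> of 0. For \<open>s < 1\<close> the cosine
  in the lower bound is positive, so \<open>exp (- (w powr s))\<close> decays in every direction of
  the half-plane.\<close>

lemma Re_powr_ge:
  fixes w :: complex and s :: real
  assumes w: "Re w > 0" and s: "0 \<le> s" "s \<le> 1"
  shows "norm w powr s * cos (s * (pi / 2)) \<le> Re (w powr of_real s)"
proof -
  have w0: "w \<noteq> 0" using w by auto
  have "\<bar>Arg w\<bar> < pi / 2" using w Re_Ln_pos_lt[OF w0] Arg_eq_Im_Ln[OF w0] by simp
  then have "s * \<bar>Arg w\<bar> \<le> s * (pi / 2)" using s by (intro mult_left_mono) auto
  then have a: "\<bar>s * Arg w\<bar> \<le> s * (pi / 2)" using s by (simp add: abs_mult)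
  have "s * (pi / 2) \<le> 1 * (pi / 2)" using s by (intro mult_right_mono) auto
  then have "cos (s * (pi / 2)) \<le> cos \<bar>s * Arg w\<bar>"
    using a s by (intro cos_monotone_0_pi_le) auto
  then have c: "cos (s * (pi / 2)) \<le> cos (s * Arg w)" by simp
  have "Re (w powr of_real s) = exp (s * ln (norm w)) * cos (s * Arg w)"
    using w0 by (simp add: powr_def Re_exp Arg_eq_Im_Ln)
  also have "exp (s * ln (norm w)) = norm w powr s" using w0 by (simp add: powr_def)
  finally show ?thesis using c by (simp add: mult_left_mono)
qed

text \<open>A factor \<open>exp (- \<eta> * (z + 1) powr s)\<close> with
  \<open>\<rho> < s < 1\<close> beats the growth of \<open>h\<close> on large arcs and has modulus
  at most 1 on the imaginary axis. The maximum principle applies on half-discs, and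
  \<open>\<eta>\<close> tends to 0 at the end. The shift by 1 keeps the base off the branch cut,
  also on the boundary.\<close>

theorem phragmen_lindelof_half_plane:
  fixes h :: "complex \<Rightarrow> complex" and A \<rho> :: real
  assumes hol: "h holomorphic_on {z. Re z > 0}" and cont: "continuous_on {z. Re z \<ge> 0} h"
    and growth: "\<And>z. Re z \<ge> 0 \<Longrightarrow> norm (h z) \<le> exp (A * norm z powr \<rho>)"
    and A: "0 \<le> A" and \<rho>: "0 \<le> \<rho>" "\<rho> < 1"
    and bd: "\<And>z. Re z = 0 \<Longrightarrow> norm (h z) \<le> 1" and z: "Re z \<ge> 0"
  shows "norm (h z) \<le> 1"
proof -
  define s where "s = (\<rho> + 1) / 2"
  have s: "\<rho> < s" "0 < s" "s < 1" using \<rho> by (auto simp: s_def)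
  define c where "c = cos (s * (pi / 2))"
  have c: "c > 0" unfolding c_def using s by (intro cos_gt_zero) auto
  have key: "norm (h z) \<le> exp (\<eta> * Re ((z + 1) powr of_real s))" if \<eta>: "\<eta> > 0" for \<eta>
  proof -
    \<comment> \<open>The second argument of \<open>max\<close> is the radius from which
      \<open>A * t powr \<rho>\<close> is at most \<open>\<eta> * c * t powr s\<close>.\<close>
    define R where "R = max (norm z) ((A / (\<eta> * c)) powr (1 / (s - \<rho>))) + 1"
    have R: "R \<ge> norm z" "R > 0" "R \<ge> (A / (\<eta> * c)) powr (1 / (s - \<rho>))"
      using norm_ge_zero[of z] by (auto simp: R_def le_max_iff_disj simp del: norm_ge_zero)
    have big: "A * t powr \<rho> \<le> \<eta> * (t powr s * c)" if t: "t \<ge> R" for t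
    proof -
      have "A / (\<eta> * c) = ((A / (\<eta> * c)) powr (1 / (s - \<rho>))) powr (s - \<rho>)"
        using s A \<eta> c by (simp add: powr_powr)
      also have "\<dots> \<le> t powr (s - \<rho>)"
        using s R t by (intro powr_mono2) auto
      finally have "A \<le> \<eta> * c * t powr (s - \<rho>)" using \<eta> c by (simp add: field_simps)
      then have "A * t powr \<rho> \<le> \<eta> * c * t powr (s - \<rho>) * t powr \<rho>" by (intro mult_right_mono) auto
      then show ?thesis using t R by (simp add: powr_diff field_simps)
    qed
    define k where "k w = h w * exp (- (of_real \<eta> * (w + 1) powr of_real s))" for w
    define S where "S = {w. Re w \<ge> 0} \<inter> cball 0 R"
    have clS: "closed S" unfolding S_def by (intro closed_Int closed_halfspace_Re_ge closed_cball)
    have nk: "norm (k w) = norm (h w) * exp (- (\<eta> * Re ((w + 1) powr of_real s)))" for w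
      by (simp add: k_def norm_mult)
    have Rew: "norm (w + 1) powr s * c \<le> Re ((w + 1) powr of_real s)" if "Re w \<ge> 0" for w
      unfolding c_def using that s by (intro Re_powr_ge) auto
    have "norm (k z) \<le> 1"
    proof (rule maximum_modulus_frontier[of k S 1 z])
      have int: "interior S \<subseteq> {w. Re w > 0}"
      proof
        fix w assume "w \<in> interior S"
        then obtain e where e: "e > 0" "cball w e \<subseteq> S" by (auto simp: mem_interior_cball)
        then have "w - of_real e \<in> S" by (auto simp: dist_norm subset_iff)
        then show "w \<in> {w. Re w > 0}" using e by (auto simp: S_def)
      qed
      have npos: "Re w \<ge> 0 \<Longrightarrow> w + 1 \<notin> \<real>\<^sub>\<le>\<^sub>0" for w :: complex
        by (auto simp: complex_nonpos_Reals_iff)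
      show "k holomorphic_on interior S"
        unfolding k_def using int npos
        by (intro holomorphic_intros holomorphic_on_subset[OF hol]) force+
      show "continuous_on (closure S) k"
        unfolding k_def closure_closed[OF clS] using npos s
        by (intro continuous_intros continuous_on_subset[OF cont]) (auto simp: S_def)
      show "bounded S" unfolding S_def by (simp add: bounded_Int)
      show "z \<in> S" using z R by (simp add: S_def)
      show "norm (k w) \<le> 1" if "w \<in> frontier S" for w
      proof -
        have w: "w \<in> S" "w \<notin> interior S" using that clS by (auto simp: frontier_def)
        then have Re0: "Re w \<ge> 0" by (simp add: S_def)
        have "\<not> (Re w > 0 \<and> norm w < R)"
        proof
          assume "Re w > 0 \<and> norm w < R"
          then have "w \<in> {w. Re w > 0} \<inter> ball 0 R" by simp
          moreover have "{w. Re w > 0} \<inter> ball 0 R \<subseteq> interior S"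
            by (intro interior_maximal open_Int open_halfspace_Re_gt open_ball) (auto simp: S_def)
          ultimately show False using w by blast
        qed
        then consider "Re w = 0" | "norm w = R" using Re0 w by (fastforce simp: S_def)
        then show ?thesis
        proof cases
          case 1
          have "0 \<le> norm (w + 1) powr s * c" using c by simp
          then have "0 \<le> \<eta> * Re ((w + 1) powr of_real s)"
            using Rew[OF Re0] \<eta> by simp
          then show ?thesis unfolding nk using bd[OF 1] by (intro mult_le_one) auto
        next
          case 2
          have "(norm w)\<^sup>2 \<le> (norm (w + 1))\<^sup>2"
            using Re0 unfolding cmod_power2 by (simp add: power2_eq_square algebra_simps)
          then have le: "norm w \<le> norm (w + 1)" by (rule power2_le_imp_le) simp
          have "A * norm w powr \<rho> \<le> A * norm (w + 1) powr \<rho>"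
            using A \<rho> le by (intro mult_left_mono powr_mono2) auto
          also have "\<dots> \<le> \<eta> * (norm (w + 1) powr s * c)" using big le 2 by simp
          also have "\<dots> \<le> \<eta> * Re ((w + 1) powr of_real s)" using Rew[OF Re0] \<eta> by simp
          finally have "norm (h w) \<le> exp (\<eta> * Re ((w + 1) powr of_real s))"
            using growth[OF Re0] by (meson exp_le_cancel_iff order_trans)
          then show ?thesis unfolding nk by (simp add: exp_minus field_simps)
        qed
      qed
    qed
    then show ?thesis unfolding nk by (simp add: exp_minus field_simps)
  qed
  show ?thesis
  proof (rule tendsto_lowerbound)
    show "((\<lambda>\<eta>. exp (\<eta> * Re ((z + 1) powr of_real s))) \<longlongrightarrow> 1) (at_right 0)"
      by (rule tendsto_eq_intros | simp)+
    show "\<forall>\<^sub>F \<eta> in at_right 0. norm (h z) \<le> exp (\<eta> * Re ((z + 1) powr of_real s))"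
      using key by (auto simp: eventually_at_filter)
  qed simp
qed

text \<open>\<open>ge1\<close> keeps the quotient finite up to the boundary, and \<open>cnj\<close>
  gives it modulus one there because \<open>- w = cnj w\<close> on the imaginary axis.
  \<open>ne\<close> excludes that it is identically 1, which the maximum principle would force if
  the value 1 were taken inside.\<close>

theorem entire_symmetric_value_imp_imaginary:
  fixes G :: "complex \<Rightarrow> complex" and A \<rho> :: real
  assumes hol: "G holomorphic_on UNIV" and cnj: "\<And>z. G (cnj z) = cnj (G z)"
    and growth: "\<And>z. norm (G z) \<le> exp (A * norm z powr \<rho>)"
    and A: "0 \<le> A" and \<rho>: "0 \<le> \<rho>" "\<rho> < 1"
    and ge1: "\<And>z. Re z \<ge> 0 \<Longrightarrow> norm (G z) \<ge> 1"
    and ne: "G (-1) \<noteq> G 1"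
    and eq: "G z = G (- z)"
  shows "Re z = 0"
proof -
  define h where "h w = G (- w) / G w" for w
  have nz: "Re w \<ge> 0 \<Longrightarrow> G w \<noteq> 0" for w using ge1[of w] by auto
  have cG: "continuous_on S G" for S
    using hol holomorphic_on_imp_continuous_on continuous_on_subset by blast
  have holm: "(\<lambda>w. G (- w)) holomorphic_on S" for S
    using holomorphic_on_compose[of uminus S G] holomorphic_on_subset[OF hol] holomorphic_on_minus[OF holomorphic_on_ident]
    by (auto simp: o_def)
  have holh: "h holomorphic_on {w. Re w > 0}"
    unfolding h_def using nz by (intro holomorphic_intros holm holomorphic_on_subset[OF hol]) auto
  have conth: "continuous_on {w. Re w \<ge> 0} h"
    unfolding h_def using nz by (intro continuous_intros cG continuous_on_compose2[OF cG[of UNIV]]) auto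
  have gh: "norm (h w) \<le> exp (A * norm w powr \<rho>)" if "Re w \<ge> 0" for w
  proof -
    have "norm (h w) = norm (G (- w)) / norm (G w)" by (simp add: h_def norm_divide)
    also have "\<dots> \<le> norm (G (-w)) / 1" using ge1[OF that] by (intro divide_left_mono) (auto simp: nz that)
    finally show ?thesis using growth[of "-w"] by simp
  qed
  have ih: "norm (h w) \<le> 1" if "Re w = 0" for w
  proof -
    have "- w = cnj w" using that by (simp add: complex_eq_iff)
    then show ?thesis using nz[of w] that by (simp add: h_def cnj norm_divide)
  qed
  have le1: "norm (h w) \<le> 1" if "Re w \<ge> 0" for w
    by (rule phragmen_lindelof_half_plane[OF holh conth gh A \<rho> ih that])
  have "\<not> (Re w > 0 \<and> G w = G (- w))" for w
  proof
    assume w: "Re w > 0 \<and> G w = G (- w)"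
    then have hw: "h w = 1" using nz[of w] by (simp add: h_def)
    have "h constant_on {w. Re w > 0}"
    proof (rule maximum_modulus_principle[OF holh])
      show "connected {w. Re w > 0}" by (intro convex_connected convex_halfspace_Re_gt)
      show "open {w. Re w > 0}" by (rule open_halfspace_Re_gt)
      then show "open {w. Re w > 0}" .
      show "w \<in> {w. Re w > 0}" using w by simp
      show "norm (h v) \<le> norm (h w)" if "v \<in> {w. Re w > 0}" for v
        using le1[of v] that hw by simp
    qed simp
    then have "h 1 = h w" using w by (auto simp: constant_on_def)
    then show False using hw ne nz[of 1] by (simp add: h_def)
  qed
  \<comment> \<open>The equation \<open>eq\<close> is symmetric in \<open>z\<close> and
    \<open>- z\<close>, so the open left half-plane is excluded too.\<close>
  from this[of z] this[of "-z"] show ?thesis using eq by force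
qed

subsection \<open>The singular equation on a half period\<close>

text \<open>Integrands below contain \<open>1 / f\<close>, which has no meaningful value at 0 or
  \<open>pi\<close>; only continuity inside the interval and boundedness are available. The
  endpoints form a null set.\<close>

lemma
  fixes g :: "real \<Rightarrow> 'a::euclidean_space"
  assumes cont: "continuous_on {a<..<b} g" and bd: "\<And>x. x \<in> {a<..<b} \<Longrightarrow> norm (g x) \<le> B"
  shows continuous_on_indefinite_integral_bounded: "continuous_on {a..b} (\<lambda>x. integral {a..x} g)"
    and has_vector_derivative_indefinite_integral_bounded:
      "x \<in> {a<..<b} \<Longrightarrow> ((\<lambda>x. integral {a..x} g) has_vector_derivative g x) (at x)"
proof -
  have "g absolutely_integrable_on {a<..<b}"
  proof (rule measurable_bounded_by_integrable_imp_absolutely_integrable)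
    show "g \<in> borel_measurable (lebesgue_on {a<..<b})"
      using cont by (rule continuous_imp_measurable_on_sets_lebesgue) simp
    show "(\<lambda>x. B) integrable_on {a<..<b}"
      unfolding integrable_on_open_interval_real by (rule integrable_const_ivl)
  qed (use bd in auto)
  then have "g integrable_on {a<..<b}"
    using set_lebesgue_integral_eq_integral(1) by blast
  then have int: "g integrable_on {a..b}"
    by (simp add: integrable_on_open_interval_real)
  then show "continuous_on {a..b} (\<lambda>x. integral {a..x} g)"
    by (rule indefinite_integral_continuous_1)
  assume x: "x \<in> {a<..<b}"
  have "isCont g x" using cont x by (simp add: continuous_on_eq_continuous_at)
  then have "((\<lambda>x. integral {a..x} g) has_vector_derivative g x) (at x within ({a..b} - {}))"
    using x by (intro integral_has_vector_derivative_continuous_at[OF int]) (auto intro: continuous_at_imp_continuous_at_within)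
  then show "((\<lambda>x. integral {a..x} g) has_vector_derivative g x) (at x)"
    using at_within_interior[of x "{a..b}"] x by simp
qed

text \<open>At a singular endpoint only one-sided limits are at hand, so the mean value inequality
  is applied on \<open>{y..x}\<close> and \<open>y\<close> is then sent to \<open>a\<close>.\<close>

lemma norm_diff_le_of_derivative_bound:
  fixes \<phi> :: "real \<Rightarrow> 'a::real_normed_vector"
  assumes \<phi>: "\<And>x. x \<in> {a<..<b} \<Longrightarrow> (\<phi> has_vector_derivative \<phi>' x) (at x)"
    and \<psi>: "\<And>x. x \<in> {a<..<b} \<Longrightarrow> (\<psi> has_real_derivative \<psi>' x) (at x)"
    and le: "\<And>x. x \<in> {a<..<b} \<Longrightarrow> norm (\<phi>' x) \<le> \<psi>' x"
    and lim: "(\<phi> \<longlongrightarrow> l) (at_right a)" "(\<psi> \<longlongrightarrow> m) (at_right a)" and x: "x \<in> {a<..<b}"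
  shows "norm (\<phi> x - l) \<le> \<psi> x - m"
proof (rule tendsto_le)
  show "((\<lambda>y. norm (\<phi> x - \<phi> y)) \<longlongrightarrow> norm (\<phi> x - l)) (at_right a)"
    "((\<lambda>y. \<psi> x - \<psi> y) \<longlongrightarrow> \<psi> x - m) (at_right a)"
    by (intro tendsto_intros lim)+
  have "norm (\<phi> x - \<phi> y) \<le> \<psi> x - \<psi> y" if y: "y \<in> {a<..<x}" for y
  proof (rule differentiable_bound_general[of y x])
    show "continuous_on {y..x} \<phi>" "continuous_on {y..x} \<psi>"
      using x y has_vector_derivative_continuous[OF \<phi>] DERIV_isCont[OF \<psi>]
      by (auto intro!: continuous_at_imp_continuous_on)
    fix t assume "y < t" "t < x"
    then have t: "t \<in> {a<..<b}" using x y by auto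
    show "(\<phi> has_vector_derivative \<phi>' t) (at t)" "(\<psi> has_vector_derivative \<psi>' t) (at t)" "norm (\<phi>' t) \<le> \<psi>' t"
      using \<phi>[OF t] \<psi>[OF t] le[OF t] by (auto simp: has_real_derivative_iff_has_vector_derivative)
  qed (use y in auto)
  then show "\<forall>\<^sub>F y in at_right a. norm (\<phi> x - \<phi> y) \<le> \<psi> x - \<psi> y"
    using x by (auto simp: eventually_at_right_field intro!: exI[of _ x])
qed simp

text \<open>The tool for comparisons started at the singular point 0: signs of derivatives replace
  integration from 0.\<close>

lemma ge_limit_of_derivative_nonneg:
  fixes \<psi> :: "real \<Rightarrow> real"
  assumes \<psi>: "\<And>x. x \<in> {a<..<b} \<Longrightarrow> (\<psi> has_real_derivative \<psi>' x) (at x)"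
    and nonneg: "\<And>x. x \<in> {a<..<b} \<Longrightarrow> 0 \<le> \<psi>' x"
    and lim: "(\<psi> \<longlongrightarrow> m) (at_right a)" and x: "x \<in> {a<..<b}"
  shows "m \<le> \<psi> x"
  using norm_diff_le_of_derivative_bound[of a b "\<lambda>_. 0::real" "\<lambda>_. 0" \<psi> \<psi>' 0 m x] assms by auto

text \<open>
  \<open>P\<close> is an integrating factor: the equation reads \<open>(P f y')' = z P y / \<epsilon>\<close>. The bound on the primitive
  \<open>R\<close> of \<open>P / \<epsilon>\<close> makes the iterated integrals below converge up to \<open>\<pi>\<close>.
\<close>

locale singular_ode =
  fixes f P R :: "real \<Rightarrow> real" and \<epsilon> M F c :: real
  assumes eps: "\<epsilon> > 0"
    and f_cont: "continuous_on {0<..<pi} f"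
    and f_pos: "\<And>x. x \<in> {0<..<pi} \<Longrightarrow> f x > 0"
    and f_le: "\<And>x. x \<in> {0<..<pi} \<Longrightarrow> f x \<le> F"
    and f_le_lin: "\<And>x. x \<in> {0<..<pi} \<Longrightarrow> f x \<le> F * x"
    and c_pos: "c > 0"
    and f_ge: "\<And>x. x \<in> {0<..<pi} \<Longrightarrow> c * min x (pi - x) \<le> f x"
    and P_pos: "\<And>x. x \<in> {0<..<pi} \<Longrightarrow> P x > 0"
    and P_deriv: "\<And>x. x \<in> {0<..<pi} \<Longrightarrow> (P has_real_derivative P x / (\<epsilon> * f x)) (at x)"
    and R_lim: "(R \<longlongrightarrow> 0) (at_right 0)"
    and R_deriv: "\<And>x. x \<in> {0<..<pi} \<Longrightarrow> (R has_real_derivative P x / \<epsilon>) (at x)"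
    and R_le: "\<And>x. x \<in> {0<..<pi} \<Longrightarrow> R x \<le> M * (P x * f x)"
begin

section \<open>Integrating factor and coefficients of the power series\<close>

lemma P_cont: "continuous_on {0<..<pi} P"
  using P_deriv DERIV_isCont by (blast intro: continuous_at_imp_continuous_on)

lemma P_mono:
  assumes "0 < x" "x \<le> y" "y < pi"
  shows "P x \<le> P y"
proof (rule DERIV_nonneg_imp_nondecreasing[OF assms(2)])
  fix t assume "x \<le> t" "t \<le> y"
  then have t: "t \<in> {0<..<pi}" using assms by auto
  show "\<exists>d. (P has_real_derivative d) (at t) \<and> 0 \<le> d"
    using P_deriv[OF t] P_pos[OF t] f_pos[OF t] eps by (intro exI conjI) auto
qed

lemma R_nonneg: "x \<in> {0<..<pi} \<Longrightarrow> R x \<ge> 0"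
  by (rule ge_limit_of_derivative_nonneg[OF R_deriv _ R_lim]) (use P_pos eps in \<open>auto simp: less_imp_le\<close>)

lemma Pf_pos: "x \<in> {0<..<pi} \<Longrightarrow> P x * f x > 0"
  using P_pos f_pos by simp

lemma M_nonneg: "M \<ge> 0"
proof -
  have "0 \<le> M * (P 1 * f 1)" using R_nonneg[of 1] R_le[of 1] pi_gt3 by simp
  then show ?thesis using Pf_pos[of 1] pi_gt3 by (simp add: zero_le_mult_iff)
qed

text \<open>\<open>u n\<close> and \<open>W n / P\<close> are the coefficients of \<open>z ^ n\<close> in \<open>y\<close> and of \<open>z ^ Suc n\<close> in \<open>f y'\<close>.\<close>

primrec u :: "nat \<Rightarrow> real \<Rightarrow> real" where
  "u 0 = (\<lambda>x. 1)"
| "u (Suc n) = (\<lambda>x. integral {0..x} (\<lambda>s. integral {0..s} (\<lambda>t. P t * u n t / \<epsilon>) / (P s * f s)))"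

definition W :: "nat \<Rightarrow> real \<Rightarrow> real" where
  "W n s = integral {0..s} (\<lambda>t. P t * u n t / \<epsilon>)"

text \<open>The invariant of the recursion. Monotonicity allows \<open>u n\<close> to be pulled out
  of an integral at its value at the upper end.\<close>

definition regular :: "(real \<Rightarrow> real) \<Rightarrow> bool" where
  "regular g \<longleftrightarrow> continuous_on {0..pi} g \<and> (\<forall>x\<in>{0..pi}. 0 \<le> g x) \<and> mono_on {0..pi} g"

lemma W_props:
  assumes "regular (u n)"
  shows W_deriv': "x \<in> {0<..<pi} \<Longrightarrow> (W n has_real_derivative P x * u n x / \<epsilon>) (at x)"
    and W_lim': "(W n \<longlongrightarrow> 0) (at_right 0)"
    and W_nonneg': "x \<in> {0<..<pi} \<Longrightarrow> 0 \<le> W n x"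
    and W_le': "x \<in> {0<..<pi} \<Longrightarrow> W n x \<le> R x * u n x"
proof -
  let ?g = "\<lambda>t. P t * u n t / \<epsilon>"
  have uc: "continuous_on {0..pi} (u n)" and u0: "\<And>x. x \<in> {0..pi} \<Longrightarrow> 0 \<le> u n x"
    and um: "\<And>x y. 0 \<le> x \<Longrightarrow> x \<le> y \<Longrightarrow> y \<le> pi \<Longrightarrow> u n x \<le> u n y"
    using assms by (auto simp: regular_def mono_on_def)
  \<comment> \<open>\<open>P\<close> may be unbounded near \<open>pi\<close>, so the integrand is
    treated on \<open>{0<..<b}\<close> with \<open>b < pi\<close>, where monotonicity bounds it by
    its value at \<open>b\<close>.\<close>
  have gc: "continuous_on {0<..<b} ?g" if "b < pi" for b
    using that eps by (intro continuous_intros continuous_on_subset[OF P_cont] continuous_on_subset[OF uc]) auto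
  have gb: "norm (?g x) \<le> P b * u n b / \<epsilon>" if "b < pi" "x \<in> {0<..<b}" for b x
    using that eps P_mono[of x b] um[of x b] P_pos[of x] u0[of x]
    by (auto simp: abs_mult intro!: divide_right_mono mult_mono)
  have Wd: "(W n has_real_derivative ?g x) (at x)" if x: "x \<in> {0<..<pi}" for x
  proof -
    obtain b where b: "x < b" "b < pi" using x by (metis dense greaterThanLessThan_iff)
    show ?thesis
      using has_vector_derivative_indefinite_integral_bounded[OF gc[OF b(2)] gb[OF b(2)], of x] x b
      by (simp add: W_def[abs_def] has_real_derivative_iff_has_vector_derivative)
  qed
  then show "x \<in> {0<..<pi} \<Longrightarrow> (W n has_real_derivative P x * u n x / \<epsilon>) (at x)" .
  have "continuous_on {0..1} (W n)"
    using continuous_on_indefinite_integral_bounded[OF gc[of 1] gb[of 1]] pi_gt3 by (simp add: W_def[abs_def])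
  then have "(W n \<longlongrightarrow> W n 0) (at_right 0)"
    by (simp add: continuous_on_Icc_at_rightD)
  then show lim: "(W n \<longlongrightarrow> 0) (at_right 0)" by (simp add: W_def)
  show "x \<in> {0<..<pi} \<Longrightarrow> 0 \<le> W n x"
    by (rule ge_limit_of_derivative_nonneg[OF Wd _ lim]) (use P_pos u0 eps in \<open>auto simp: less_imp_le\<close>)
  assume x: "x \<in> {0<..<pi}"
  obtain b where b: "x < b" "b < pi" using x by (metis dense greaterThanLessThan_iff)
  show "W n x \<le> R x * u n x"
  proof -
    have l: "((\<lambda>y. R y * u n x - W n y) \<longlongrightarrow> 0 * u n x - 0) (at_right 0)"
      by (intro tendsto_intros R_lim lim)
    \<comment> \<open>With \<open>u n\<close> frozen at \<open>x\<close>, the comparison is made on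
      \<open>{0<..<x}\<close>; continuity then carries it to \<open>x\<close> itself.\<close>
    have "0 * u n x - 0 \<le> R y * u n x - W n y" if "y \<in> {0<..<x}" for y
    proof (rule ge_limit_of_derivative_nonneg[OF _ _ l that])
      fix t assume t: "t \<in> {0<..<x}"
      then have t': "t \<in> {0<..<pi}" using x by auto
      show "((\<lambda>y. R y * u n x - W n y) has_real_derivative P t / \<epsilon> * u n x - ?g t) (at t)"
        by (intro derivative_intros DERIV_cmult_right R_deriv Wd t')
      show "0 \<le> P t / \<epsilon> * u n x - ?g t"
        using um[of t x] t x P_pos[OF t'] eps by (simp add: field_simps)
    qed
    then have ev: "\<forall>\<^sub>F y in at_left x. W n y \<le> R y * u n x"
      using x by (auto simp: eventually_at_left_field intro!: exI[of _ 0])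
    have "isCont (W n) x" "isCont R x" using Wd[OF x] R_deriv[OF x] DERIV_isCont by blast+
    then have lims: "(W n \<longlongrightarrow> W n x) (at_left x)" "((\<lambda>y. R y * u n x) \<longlongrightarrow> R x * u n x) (at_left x)"
      by (auto simp: isCont_def intro!: tendsto_intros intro: filterlim_at_split[THEN iffD1, THEN conjunct1])
    show ?thesis by (rule tendsto_le[OF _ lims(2,1) ev]) simp
  qed
qed

text \<open>Combining \<open>W n \<le> R * u n\<close> with \<open>R_le\<close> cancels the factor
  \<open>1 / (P * f)\<close>. The derivative of \<open>u (Suc n)\<close> is thus bounded up to
  \<open>pi\<close>, and the outer integral converges there.\<close>

lemma u_Suc_props:
  assumes reg: "regular (u n)"
  shows u_Suc_deriv': "x \<in> {0<..<pi} \<Longrightarrow> (u (Suc n) has_real_derivative W n x / (P x * f x)) (at x)"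
    and u_Suc_deriv_le': "x \<in> {0<..<pi} \<Longrightarrow> W n x / (P x * f x) \<le> M * u n x"
    and u_Suc_regular: "regular (u (Suc n))"
proof -
  let ?g = "\<lambda>s. W n s / (P s * f s)"
  have uc: "continuous_on {0..pi} (u n)" and u0: "\<And>x. x \<in> {0..pi} \<Longrightarrow> 0 \<le> u n x"
    and um: "\<And>x y. 0 \<le> x \<Longrightarrow> x \<le> y \<Longrightarrow> y \<le> pi \<Longrightarrow> u n x \<le> u n y"
    using reg by (auto simp: regular_def mono_on_def)
  note W = W_props[OF reg]
  have le: "?g x \<le> M * u n x" if x: "x \<in> {0<..<pi}" for x
  proof -
    have "W n x \<le> R x * u n x" using W(4)[OF x] .
    also have "\<dots> \<le> M * (P x * f x) * u n x" using R_le[OF x] u0[of x] x by (intro mult_right_mono) auto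
    finally show ?thesis using Pf_pos[OF x] by (simp add: field_simps)
  qed
  then show "x \<in> {0<..<pi} \<Longrightarrow> W n x / (P x * f x) \<le> M * u n x" .
  have g0: "0 \<le> ?g x" if "x \<in> {0<..<pi}" for x
    using W(3)[OF that] Pf_pos[OF that] by simp
  have gb: "norm (?g x) \<le> M * u n pi" if x: "x \<in> {0<..<pi}" for x
    using le[OF x] g0[OF x] um[of x pi] x M_nonneg mult_left_mono[of "u n x" "u n pi" M] by simp
  have "continuous_on {0<..<pi} (W n)"
    using W(1) by (intro continuous_at_imp_continuous_on) (blast intro: DERIV_isCont)
  then have gc: "continuous_on {0<..<pi} ?g"
    using P_cont f_cont Pf_pos by (intro continuous_intros) force+
  have us: "u (Suc n) = (\<lambda>x. integral {0..x} ?g)" by (simp add: W_def[abs_def])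
  show d: "(u (Suc n) has_real_derivative ?g x) (at x)" if "x \<in> {0<..<pi}" for x
    unfolding us has_real_derivative_iff_has_vector_derivative
    by (rule has_vector_derivative_indefinite_integral_bounded[OF gc gb that])
  have c: "continuous_on {0..pi} (u (Suc n))"
    unfolding us by (rule continuous_on_indefinite_integral_bounded[OF gc gb])
  have m: "u (Suc n) x \<le> u (Suc n) y" if "0 \<le> x" "x \<le> y" "y \<le> pi" for x y
  proof (rule DERIV_nonneg_imp_increasing_open[OF that(2)])
    fix t assume "x < t" "t < y"
    then have "t \<in> {0<..<pi}" using that by auto
    then show "\<exists>y. (u (Suc n) has_real_derivative y) (at t) \<and> 0 \<le> y" using d g0 by blast
  qed (rule continuous_on_subset[OF c], use that in auto)
  show "regular (u (Suc n))"
    unfolding regular_def using c m m[of 0] us by (auto simp: mono_on_def simp del: u.simps)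
qed

lemma u_regular: "regular (u n)"
proof (induction n)
  case 0
  show ?case by (simp add: regular_def mono_on_def)
qed (rule u_Suc_regular)

lemmas W_deriv = W_deriv'[OF u_regular] and W_lim = W_lim'[OF u_regular]
  and W_nonneg = W_nonneg'[OF u_regular] and W_le = W_le'[OF u_regular]
  and u_Suc_deriv = u_Suc_deriv'[OF u_regular] and u_Suc_deriv_le = u_Suc_deriv_le'[OF u_regular]

lemma u_cont: "continuous_on {0..pi} (u n)" and u_nonneg: "x \<in> {0..pi} \<Longrightarrow> 0 \<le> u n x"
  and u_mono: "0 \<le> x \<Longrightarrow> x \<le> y \<Longrightarrow> y \<le> pi \<Longrightarrow> u n x \<le> u n y"
  using u_regular[of n] by (auto simp: regular_def mono_on_def)

declare u.simps(2) [simp del]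

lemma u_Suc_0 [simp]: "u (Suc n) 0 = 0"
  by (simp add: u.simps(2))

text \<open>Iterated integration of the bound \<open>M * u n\<close> for the derivative of
  \<open>u (Suc n)\<close>.\<close>

lemma u_le: "x \<in> {0..pi} \<Longrightarrow> u n x \<le> (M * x) ^ n / fact n"
proof (induction n arbitrary: x)
  case (Suc n)
  let ?h = "\<lambda>x. (M * x) ^ Suc n / fact (Suc n) - u (Suc n) x"
  have "?h 0 \<le> ?h x"
  proof (rule DERIV_nonneg_imp_increasing_open[of 0 x ?h])
    fix t assume "0 < t" "t < x"
    then have t: "t \<in> {0<..<pi}" using Suc.prems by auto
    have "(?h has_real_derivative (real (Suc n) * (M * t) ^ n * M / fact (Suc n) - W n t / (P t * f t))) (at t)"
      by (rule derivative_eq_intros u_Suc_deriv t refl | simp)+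
    moreover have "real (Suc n) * (M * t) ^ n * M / fact (Suc n) = M * ((M * t) ^ n / fact n)"
      by (simp add: field_simps del: of_nat_Suc)
    moreover have "W n t / (P t * f t) \<le> M * ((M * t) ^ n / fact n)"
      using u_Suc_deriv_le[OF t, of n] mult_left_mono[OF Suc.IH[of t] M_nonneg] t by auto
    ultimately show "\<exists>y. (?h has_real_derivative y) (at t) \<and> 0 \<le> y"
      by (metis diff_ge_0_iff_ge)
  next
    show "continuous_on {0..x} ?h"
      using Suc.prems by (intro continuous_intros continuous_on_subset[OF u_cont]) auto
  qed (use Suc.prems in auto)
  then show ?case by simp
qed simp

section \<open>Truncated power series and their derivatives\<close>

definition S :: "nat \<Rightarrow> 'a::real_normed_field \<Rightarrow> real \<Rightarrow> 'a" where
  "S N z x = (\<Sum>n<N. z ^ n * of_real (u n x))"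

text \<open>Truncation of \<open>P * f * y'\<close>. The indices do not close up: \<open>E N\<close>
  is \<open>P * f\<close> times the derivative of \<open>S (Suc N)\<close>, whereas the derivative
  of \<open>E N\<close> involves \<open>S N\<close>. The missing top term \<open>z ^ N * u N\<close>
  is the truncation error. The type is general because both real and complex \<open>z\<close>
  occur.\<close>

definition E :: "nat \<Rightarrow> 'a::real_normed_field \<Rightarrow> real \<Rightarrow> 'a" where
  "E N z x = (\<Sum>n<N. z ^ Suc n * of_real (W n x))"

lemma S_cont: "continuous_on {0..pi} (S N z)"
  unfolding S_def by (intro continuous_intros u_cont)

lemma S_0 [simp]: "S (Suc N) z 0 = 1"
  by (simp add: S_def sum.lessThan_Suc_shift del: sum.lessThan_Suc)

lemma S_lim: "(S (Suc N) z \<longlongrightarrow> 1) (at_right 0)"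
  using continuous_on_Icc_at_rightD[OF S_cont[of "Suc N" z]] by simp

lemma S_deriv:
  assumes "x \<in> {0<..<pi}"
  shows "(S (Suc N) z has_vector_derivative E N z x / of_real (P x * f x)) (at x)"
proof -
  have S: "S (Suc N) z = (\<lambda>x. 1 + (\<Sum>n<N. z ^ Suc n * of_real (u (Suc n) x)))"
    by (simp add: S_def fun_eq_iff sum.lessThan_Suc_shift del: sum.lessThan_Suc)
  have "((\<lambda>x. 1 + (\<Sum>n<N. z ^ Suc n * of_real (u (Suc n) x))) has_vector_derivative
      0 + (\<Sum>n<N. z ^ Suc n * of_real (W n x / (P x * f x)))) (at x)"
    by (intro has_vector_derivative_add has_vector_derivative_const has_vector_derivative_sum
      has_vector_derivative_mult_right has_vector_derivative_of_real u_Suc_deriv assms)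
  then show ?thesis by (simp add: S E_def sum_divide_distrib)
qed

lemma E_deriv:
  assumes "x \<in> {0<..<pi}"
  shows "(E N z has_vector_derivative z * of_real (P x / \<epsilon>) * S N z x) (at x)"
proof -
  have "(E N z has_vector_derivative (\<Sum>n<N. z ^ Suc n * of_real (P x * u n x / \<epsilon>))) (at x)"
    unfolding E_def by (intro has_vector_derivative_sum has_vector_derivative_mult_right
      has_vector_derivative_of_real W_deriv assms)
  then show ?thesis by (simp add: S_def sum_distrib_left mult_ac)
qed

lemma E_lim: "(E N z \<longlongrightarrow> 0) (at_right 0)"
proof -
  have "(E N z \<longlongrightarrow> (\<Sum>n<N. z ^ Suc n * of_real 0)) (at_right 0)"
    unfolding E_def by (intro tendsto_intros W_lim)
  then show ?thesis by simp
qed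

lemma norm_S_le:
  assumes x: "x \<in> {0..pi}"
  shows "norm (S N z x) \<le> S N (norm z) x"
  unfolding S_def using u_nonneg[OF x] by (intro sum_norm_le) (simp add: norm_mult norm_power)

lemma S_real_le_exp:
  assumes x: "x \<in> {0..pi}" and r: "r \<ge> 0"
  shows "S N r x \<le> exp (r * M * x)"
proof -
  have "S N r x \<le> (\<Sum>n<N. (r * M * x) ^ n /\<^sub>R fact n)"
    unfolding S_def
  proof (rule sum_mono)
    fix n
    have "r ^ n * u n x \<le> r ^ n * ((M * x) ^ n / fact n)"
      using u_le[OF x] r by (intro mult_left_mono) auto
    then show "r ^ n * of_real (u n x) \<le> (r * M * x) ^ n /\<^sub>R fact n"
      by (simp add: power_mult_distrib divide_inverse mult_ac)
  qed
  also have "\<dots> \<le> exp (r * M * x)"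
    unfolding exp_def using r M_nonneg x by (intro sum_le_suminf summable_exp_generic) auto
  finally show ?thesis .
qed

section \<open>The entire function \<open>G\<close>\<close>

definition G :: "complex \<Rightarrow> complex" where
  "G z = (\<Sum>n. of_real (u n pi) * z ^ n)"

lemma summable_G: "summable (\<lambda>n. of_real (u n pi) * z ^ n :: complex)"
proof (rule summable_comparison_test')
  show "summable (\<lambda>n. (norm z * (M * pi)) ^ n /\<^sub>R fact n)" by (rule summable_exp_generic)
  show "norm (of_real (u n pi) * z ^ n) \<le> (norm z * (M * pi)) ^ n /\<^sub>R fact n" if "n \<ge> 0" for n
    using mult_left_mono[OF u_le[of pi n], of "norm z ^ n"] u_nonneg[of pi n]
    by (simp add: norm_mult norm_power power_mult_distrib divide_inverse mult_ac)
qed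

lemma S_LIMSEQ_G: "(\<lambda>N. S N z pi) \<longlonglongrightarrow> G z"
  using summable_LIMSEQ[OF summable_G[of z]] by (simp add: S_def G_def mult.commute)

lemma G_holomorphic: "G holomorphic_on UNIV"
proof -
  have "G field_differentiable (at z)" for z
    unfolding field_differentiable_def G_def[abs_def]
    using termdiffs_strong_converges_everywhere[of "\<lambda>n. of_real (u n pi)" z] summable_G by blast
  then show ?thesis by (simp add: holomorphic_on_def)
qed

lemma G_cnj: "G (cnj z) = cnj (G z)"
proof -
  have "(\<lambda>N. cnj (S N z pi)) \<longlonglongrightarrow> cnj (G z)"
    by (intro tendsto_cnj S_LIMSEQ_G)
  moreover have "cnj (S N z pi) = S N (cnj z) pi" for N
    by (simp add: S_def)
  ultimately show ?thesis using S_LIMSEQ_G[of "cnj z"] LIMSEQ_unique by simp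
qed

lemma u_Suc_0_pos: "u (Suc 0) pi > 0"
proof -
  have W: "W 0 x > 0" if x: "x \<in> {0<..<pi}" for x
  proof -
    have m: "x / 2 \<in> {0<..<pi}" using x by auto
    have "W 0 (x/2) < W 0 x"
    proof (rule DERIV_pos_imp_increasing[of "x/2" x])
      fix t assume "x / 2 \<le> t" "t \<le> x"
      then have t: "t \<in> {0<..<pi}" using x by auto
      show "\<exists>y. (W 0 has_real_derivative y) (at t) \<and> 0 < y"
        using W_deriv[OF t, of 0] P_pos[OF t] eps by (intro exI[of _ "P t * u 0 t / \<epsilon>"] conjI) auto
    qed (use x in auto)
    then show ?thesis using W_nonneg[OF m, of 0] by linarith
  qed
  have "u (Suc 0) 0 < u (Suc 0) pi"
  proof (rule DERIV_pos_imp_increasing_open[of 0 pi])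
    fix t :: real assume "0 < t" "t < pi"
    then have t: "t \<in> {0<..<pi}" by auto
    show "\<exists>y. (u (Suc 0) has_real_derivative y) (at t) \<and> 0 < y"
      using u_Suc_deriv[OF t, of 0] W[OF t] Pf_pos[OF t]
      by (intro exI[of _ "W 0 t / (P t * f t)"] conjI divide_pos_pos)
  qed (use u_cont in auto)
  then show ?thesis by simp
qed

text \<open>\<open>G 1 - G (-1)\<close> is twice the sum of the coefficients of odd index; these are
  nonnegative and the first is positive.\<close>

lemma G_neg_1_neq_G_1: "G (-1) \<noteq> G 1"
proof
  assume eq: "G (-1) = G 1"
  have "2 * u 1 pi \<le> Re (G 1 - G (-1))"
  proof (rule LIMSEQ_le_const)
    show "(\<lambda>N. Re (S N 1 pi - S N (-1) pi)) \<longlonglongrightarrow> Re (G 1 - G (-1))"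
      by (intro tendsto_intros S_LIMSEQ_G)
    have "2 * u 1 pi \<le> Re (S N 1 pi - S N (-1) pi)" if "N \<ge> 2" for N
    proof -
      have d: "Re (S N 1 pi - S N (-1) pi) = (\<Sum>n<N. (1 - (-1) ^ n) * u n pi)"
      proof -
        have "S N 1 pi - S N (-1) pi = of_real (\<Sum>n<N. (1 - (-1) ^ n) * u n pi)"
          by (simp add: S_def flip: sum_subtractf) (simp add: algebra_simps)
        then show ?thesis by (metis Re_complex_of_real)
      qed
      have "(\<Sum>n\<in>{1}. (1 - (-1) ^ n) * u n pi) \<le> (\<Sum>n<N. (1 - (-1) ^ n) * u n pi)"
        using that u_nonneg[of pi] by (intro sum_mono2 mult_nonneg_nonneg) (auto simp: uminus_power_if)
      then show ?thesis using d by simp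
    qed
    then show "\<exists>N. \<forall>n\<ge>N. 2 * u 1 pi \<le> Re (S n 1 pi - S n (-1) pi)" by blast
  qed
  then show False using eq u_Suc_0_pos by simp
qed

section \<open>Energy estimate in the right half-plane\<close>

lemma has_real_derivative_Re_mult_cnj:
  assumes "(p has_vector_derivative p') (at x)" "(q has_vector_derivative q') (at x)"
  shows "((\<lambda>x. Re (p x * cnj (q x))) has_real_derivative Re (p x * cnj q' + p' * cnj (q x))) (at x)"
  using assms unfolding has_real_derivative_iff_has_vector_derivative
  by (intro bounded_linear.has_vector_derivative[OF bounded_linear_Re] has_vector_derivative_mult
    bounded_linear.has_vector_derivative[OF bounded_linear_cnj])

text \<open>
  For a solution, \<open>Re (P f y' cnj y)\<close> has nonnegative derivative and vanishes at \<open>0\<close>, so \<open>\<bar>y\<bar>\<close> increases.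
  The argument is run on partial sums, where truncation costs an error \<open>\<delta> N\<close> tending to \<open>0\<close>.
\<close>

lemma norm_G_ge_1:
  assumes z: "Re z \<ge> 0"
  shows "norm (G z) \<ge> 1"
proof -
  \<comment> \<open>\<open>B\<close> bounds the truncated solution, and \<open>\<delta> N\<close>
    bounds the product of \<open>z\<close>, the dropped top term and that solution. Up to a
    constant, \<open>\<delta> N\<close> is a term of an exponential series.\<close>
  define B where "B = exp (norm z * M * pi)"
  define \<delta> where "\<delta> N = norm z * B * ((norm z * (M * pi)) ^ N /\<^sub>R fact N)" for N
  have energy: "1 - 2 * \<delta> N * M * pi \<le> (norm (S (Suc N) z pi))\<^sup>2" for N
  proof -
    let ?U = "S (Suc N) z" and ?E = "E N z"
    have re: "Re (of_real a * w) = a * Re w" "Re (w * of_real a) = Re w * a" for a w by simp_all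
    define q where "q x = Re (?E x * cnj (?U x))" for x
    have UB: "norm (?U x) \<le> B" if x: "x \<in> {0<..<pi}" for x
    proof -
      have "norm (?U x) \<le> S (Suc N) (norm z) x" using x by (intro norm_S_le) auto
      also have "\<dots> \<le> exp (norm z * M * x)" using x by (intro S_real_le_exp) auto
      also have "\<dots> \<le> B" unfolding B_def using x M_nonneg by (simp add: mult_left_mono)
      finally show ?thesis .
    qed
    have \<delta>0: "0 \<le> \<delta> N" unfolding \<delta>_def B_def using M_nonneg by simp
    \<comment> \<open>The derivative of \<open>q\<close> is a nonnegative square term plus
      \<open>P / \<epsilon>\<close> times a quantity at least \<open>- \<delta> N\<close>. As
      \<open>P / \<epsilon>\<close> is the derivative of \<open>R\<close>, adding
      \<open>\<delta> N * R\<close> makes it nonnegative.\<close>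
    have qge: "- \<delta> N * R x \<le> q x" if x: "x \<in> {0<..<pi}" for x
    proof -
      let ?k = "\<lambda>x. q x + \<delta> N * R x"
      have "0 \<le> ?k x"
      proof (rule ge_limit_of_derivative_nonneg[OF _ _ _ x])
        show "((\<lambda>x. q x + \<delta> N * R x) \<longlongrightarrow> 0) (at_right 0)"
          unfolding q_def by (rule tendsto_eq_intros E_lim S_lim R_lim refl | simp)+
        fix t assume t: "t \<in> {0<..<pi}"
        let ?q' = "Re (?E t * cnj (?E t / of_real (P t * f t)) + z * of_real (P t / \<epsilon>) * S N z t * cnj (?U t))"
        show "(?k has_real_derivative ?q' + \<delta> N * (P t / \<epsilon>)) (at t)"
          unfolding q_def
          by (intro derivative_intros DERIV_cmult has_real_derivative_Re_mult_cnj E_deriv S_deriv R_deriv t)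
        have "?E t * cnj (?E t / of_real (P t * f t)) = of_real ((norm (?E t))\<^sup>2 / (P t * f t))"
          unfolding of_real_divide complex_norm_square complex_cnj_divide by simp
        then have e1: "0 \<le> Re (?E t * cnj (?E t / of_real (P t * f t)))"
          using Pf_pos[OF t] by simp
        have sN: "S N z t = ?U t - z ^ N * of_real (u N t)" by (simp add: S_def)
        have "z * of_real (P t / \<epsilon>) * S N z t * cnj (?U t) =
            of_real (P t / \<epsilon>) * (z * of_real ((norm (?U t))\<^sup>2) - z * z ^ N * of_real (u N t) * cnj (?U t))"
          unfolding complex_norm_square sN by (simp add: algebra_simps)
        then have e2: "Re (z * of_real (P t / \<epsilon>) * S N z t * cnj (?U t)) =
            P t / \<epsilon> * (Re z * (norm (?U t))\<^sup>2 - Re (z * z ^ N * of_real (u N t) * cnj (?U t)))"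
          by (simp only: re minus_complex.simps)
        have "u N t \<le> (M * pi) ^ N / fact N"
          using u_mono[of t pi N] u_le[of pi N] t by auto
        then have "norm z * norm z ^ N * u N t * norm (?U t) \<le> norm z * norm z ^ N * ((M * pi) ^ N / fact N) * B"
          using UB[OF t] u_nonneg[of t N] t M_nonneg
          by (intro mult_mono mult_nonneg_nonneg) auto
        then have "norm (z * z ^ N * of_real (u N t) * cnj (?U t)) \<le> norm z * norm z ^ N * ((M * pi) ^ N / fact N) * B"
          using u_nonneg[of t N] t by (simp add: norm_mult norm_power)
        also have "\<dots> = \<delta> N" by (simp add: \<delta>_def power_mult_distrib divide_inverse mult_ac)
        finally have "Re (z * z ^ N * of_real (u N t) * cnj (?U t)) \<le> \<delta> N"
          using complex_Re_le_cmod order_trans by blast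
        then have "- \<delta> N \<le> Re z * (norm (?U t))\<^sup>2 - Re (z * z ^ N * of_real (u N t) * cnj (?U t))"
          using z by (smt (verit) mult_nonneg_nonneg zero_le_power2)
        then have "P t / \<epsilon> * (- \<delta> N) \<le> Re (z * of_real (P t / \<epsilon>) * S N z t * cnj (?U t))"
          unfolding e2 using P_pos[OF t] eps by (intro mult_left_mono) auto
        then show "0 \<le> ?q' + \<delta> N * (P t / \<epsilon>)" using e1 by (simp add: mult.commute)
      qed
      then show ?thesis by simp
    qed
    \<comment> \<open>By \<open>R_le\<close>, \<open>q / (P * f)\<close> is at least
      \<open>- \<delta> N * M\<close>. It is half the derivative of the squared modulus, so the
      linear term compensates for the loss.\<close>
    let ?n = "\<lambda>x. Re (?U x * cnj (?U x)) + 2 * \<delta> N * M * x"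
    have "?n 0 \<le> ?n pi"
    proof (rule DERIV_nonneg_imp_increasing_open[of 0 pi ?n])
      show "continuous_on {0..pi} ?n" by (intro continuous_intros S_cont)
      fix t :: real assume "0 < t" "t < pi"
      then have t: "t \<in> {0<..<pi}" by auto
      let ?D = "?E t / of_real (P t * f t)"
      have d: "(?n has_real_derivative Re (?U t * cnj ?D + ?D * cnj (?U t)) + 2 * \<delta> N * M * 1) (at t)"
        by (intro derivative_intros DERIV_cmult has_real_derivative_Re_mult_cnj S_deriv t)
      have D: "?D * cnj (?U t) = of_real (1 / (P t * f t)) * (?E t * cnj (?U t))" by simp
      have "Re (?U t * cnj ?D + ?D * cnj (?U t)) = 2 * Re (?D * cnj (?U t))" by (simp add: mult.commute)
      then have e: "Re (?U t * cnj ?D + ?D * cnj (?U t)) = 2 * (q t / (P t * f t))"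
        unfolding D re q_def by simp
      have "- (\<delta> N * (M * (P t * f t))) \<le> q t"
        using qge[OF t] mult_left_mono[OF R_le[OF t] \<delta>0] by linarith
      then have "- (\<delta> N * M) \<le> q t / (P t * f t)"
        using Pf_pos[OF t] by (simp add: field_simps)
      then show "\<exists>y. (?n has_real_derivative y) (at t) \<and> 0 \<le> y"
        using d e by (intro exI[of _ "Re (?U t * cnj ?D + ?D * cnj (?U t)) + 2 * \<delta> N * M * 1"] conjI) auto
    qed simp
    then show ?thesis by (simp add: complex_mult_cnj cmod_power2)
  qed
  have "1 \<le> (norm (G z))\<^sup>2"
  proof (rule LIMSEQ_le)
    have "\<delta> \<longlonglongrightarrow> norm z * B * 0"
      unfolding \<delta>_def by (intro tendsto_intros summable_LIMSEQ_zero summable_exp_generic)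
    then show "(\<lambda>N. 1 - 2 * \<delta> N * M * pi) \<longlonglongrightarrow> 1"
      by (auto intro!: tendsto_eq_intros)
    show "(\<lambda>N. (norm (S (Suc N) z pi))\<^sup>2) \<longlonglongrightarrow> (norm (G z))\<^sup>2"
      by (intro tendsto_intros LIMSEQ_Suc S_LIMSEQ_G)
  qed (use energy in auto)
  then show ?thesis using power2_le_imp_le[of 1 "norm (G z)"] by simp
qed

section \<open>Growth of \<open>G\<close> with exponent 3/4\<close>

lemma F_pos: "F > 0"
  using f_le[of 1] f_pos[of 1] pi_gt3 by simp

text \<open>
  Write \<open>V = f U'\<close>. The geometric mean of \<open>V \<le> r M f U\<close> and \<open>\<epsilon> V\<^sup>2 \<le> r F U\<^sup>2\<close> bounds \<open>U' / U\<close> by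
  \<open>r powr (3/4)\<close> times a multiple of \<open>1 / sqrt f\<close>, which is integrable.
\<close>

lemma S_growth:
  assumes r: "r \<ge> 0"
  shows "S (Suc N) r pi \<le> exp (4 * sqrt pi * sqrt (M * sqrt (F / \<epsilon>) / c) * r powr (3/4))"
proof -
  let ?U = "S (Suc N) r"
  define V where "V = (\<lambda>x. E N r x / P x)"
  define a where "a = r powr (3/4)"
  have a2: "a\<^sup>2 = r * sqrt r"
  proof -
    have "a\<^sup>2 = r powr (3/4) * r powr (3/4)" by (simp add: a_def power2_eq_square)
    also have "\<dots> = r powr 1 * r powr (1/2)" by (simp only: powr_add[symmetric]) simp
    finally show ?thesis using r by (simp add: powr_half_sqrt)
  qed
  have S0: "0 \<le> S n r x" if "x \<in> {0..pi}" for n x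
    unfolding S_def using that r u_nonneg by (intro sum_nonneg) auto
  have SU: "S N r x \<le> ?U x" if "x \<in> {0..pi}" for x
    using that r u_nonneg[OF that] by (simp add: S_def)
  have E0: "0 \<le> E N r x" if "x \<in> {0<..<pi}" for x
    unfolding E_def using that r W_nonneg by (intro sum_nonneg) auto
  then have V0: "0 \<le> V x" if "x \<in> {0<..<pi}" for x
    using that P_pos[OF that] by (simp add: V_def)
  have VM: "V x \<le> r * M * f x * ?U x" if x: "x \<in> {0<..<pi}" for x
  proof -
    have "E N r x \<le> (\<Sum>n<N. r ^ Suc n * (R x * u n x))"
      unfolding E_def using r W_le[OF x] by (intro sum_mono mult_left_mono) auto
    also have "\<dots> = r * R x * S N r x" by (simp add: S_def sum_distrib_left mult_ac)
    also have "\<dots> \<le> r * (M * (P x * f x)) * ?U x"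
      using r R_le[OF x] R_nonneg[OF x] SU[of x] S0[of x] M_nonneg P_pos[OF x] f_pos[OF x] x
      by (intro mult_mono mult_left_mono mult_nonneg_nonneg) auto
    finally show ?thesis using P_pos[OF x] by (simp add: V_def field_simps)
  qed
  have U': "(?U has_real_derivative V x / f x) (at x)" if x: "x \<in> {0<..<pi}" for x
    using S_deriv[OF x, of N r] by (simp add: V_def has_real_derivative_iff_has_vector_derivative)
  have V': "(V has_real_derivative (r * S N r x - V x / f x) / \<epsilon>) (at x)" if x: "x \<in> {0<..<pi}" for x
  proof -
    have "(E N r has_real_derivative r * (P x / \<epsilon>) * S N r x) (at x)"
      using E_deriv[OF x, of N r] by (simp add: has_real_derivative_iff_has_vector_derivative)
    from DERIV_divide[OF this P_deriv[OF x]] show ?thesis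
      unfolding V_def by (rule DERIV_cong) (use P_pos[OF x] f_pos[OF x] eps in \<open>auto simp: field_simps\<close>)
  qed
  have Vlim: "(V \<longlongrightarrow> 0) (at_right 0)"
  proof (rule tendsto_sandwich)
    have ev: "\<forall>\<^sub>F x in at_right 0. x \<in> {0<..<pi}"
      by (auto simp: eventually_at_right_field intro!: exI[of _ pi])
    then show "\<forall>\<^sub>F x in at_right 0. 0 \<le> V x" by eventually_elim (rule V0)
    show "\<forall>\<^sub>F x in at_right 0. V x \<le> r * M * (F * x) * ?U x" using ev
    proof eventually_elim
      case (elim x)
      have "r * M * f x * ?U x \<le> r * M * (F * x) * ?U x"
        using f_le_lin[OF elim] S0[of x] elim r M_nonneg by (intro mult_right_mono mult_left_mono) auto
      then show ?case using VM[OF elim] by linarith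
    qed
    show "((\<lambda>x. r * M * (F * x) * ?U x) \<longlongrightarrow> 0) (at_right 0)"
      by (rule tendsto_eq_intros S_lim refl | simp)+
  qed simp
  have VU: "\<epsilon> * (V x)\<^sup>2 \<le> r * F * (?U x)\<^sup>2" if x: "x \<in> {0<..<pi}" for x
  proof -
    \<comment> \<open>The derivative of \<open>?k\<close> is
      \<open>2 * r * V * (F * ?U / f - S N r) + 2 * V\<^sup>2 / f\<close>, which is nonnegative
      because \<open>f \<le> F\<close> and \<open>S N r \<le> ?U\<close>.\<close>
    let ?k = "\<lambda>x. r * F * (?U x)\<^sup>2 - \<epsilon> * (V x)\<^sup>2"
    have "r * F \<le> ?k x"
    proof (rule ge_limit_of_derivative_nonneg[OF _ _ _ x])
      show "(?k \<longlongrightarrow> r * F) (at_right 0)"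
        by (rule tendsto_eq_intros S_lim Vlim refl | simp)+
      fix t assume t: "t \<in> {0<..<pi}"
      let ?k' = "r * F * (2 * ?U t * (V t / f t)) - \<epsilon> * (2 * V t * ((r * S N r t - V t / f t) / \<epsilon>))"
      show "(?k has_real_derivative ?k') (at t)"
        by (rule derivative_eq_intros U' V' t refl | simp)+
      have "S N r t * f t \<le> ?U t * F"
        using SU[of t] S0[of t] f_le[OF t] f_pos[OF t] t by (intro mult_mono) auto
      then have "S N r t \<le> F * ?U t / f t" using f_pos[OF t] by (simp add: field_simps)
      then have "0 \<le> 2 * r * V t * (F * ?U t / f t - S N r t)"
        using r V0[OF t] by simp
      also have "\<dots> \<le> 2 * r * V t * (F * ?U t / f t - S N r t) + 2 * (V t)\<^sup>2 / f t"
        using f_pos[OF t] by simp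
      also have "\<dots> = ?k'"
        using f_pos[OF t] eps by (simp add: field_simps power2_eq_square)
      finally show "0 \<le> ?k'" .
    qed
    moreover have "0 \<le> r * F" using r F_pos by simp
    ultimately show ?thesis by linarith
  qed
  \<comment> \<open>In the product of the two bounds on \<open>V / f\<close> the powers
    \<open>r\<close> and \<open>sqrt r\<close> combine to \<open>a\<^sup>2\<close>, and
    \<open>1 / c\<close> comes from bounding \<open>1 / f\<close> by means of \<open>f_ge\<close>;
    \<open>K\<close> is the square root of the constant part.\<close>
  define K where "K = sqrt (M * sqrt (F / \<epsilon>) / c) * a"
  have K0: "K \<ge> 0" by (simp add: K_def a_def M_nonneg c_pos less_imp_le F_pos eps)
  have U'_le: "V x / f x \<le> K * (1 / sqrt x + 1 / sqrt (pi - x)) * ?U x" if x: "x \<in> {0<..<pi}" for x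
  proof (rule power2_le_imp_le)
    let ?h = "1 / sqrt x + 1 / sqrt (pi - x)"
    show "0 \<le> K * ?h * ?U x" using K0 S0[of x] x by simp
    have "(V x)\<^sup>2 \<le> (sqrt (r * F / \<epsilon>) * ?U x)\<^sup>2"
      using VU[OF x] r F_pos eps by (simp add: power_mult_distrib field_simps)
    then have Vs: "V x \<le> sqrt (r * F / \<epsilon>) * ?U x"
      by (rule power2_le_imp_le) (use S0[of x] r F_pos eps x in auto)
    have "1 / f x \<le> 1 / (c * min x (pi - x))"
      using f_ge[OF x] c_pos x f_pos[OF x] by (intro divide_left_mono) (auto simp: min_def)
    also have "\<dots> \<le> ?h\<^sup>2 / c"
    proof -
      have "(1 / sqrt x)\<^sup>2 \<le> ?h\<^sup>2" "(1 / sqrt (pi - x))\<^sup>2 \<le> ?h\<^sup>2"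
        using x by (intro power_mono; simp)+
      then have "1 / min x (pi - x) \<le> ?h\<^sup>2"
        using x by (auto simp: min_def power_divide)
      then have "1 / min x (pi - x) / c \<le> ?h\<^sup>2 / c" using c_pos by (intro divide_right_mono) auto
      then show ?thesis by (simp add: mult.commute)
    qed
    finally have fh: "1 / f x \<le> ?h\<^sup>2 / c" .
    have "V x / f x \<le> r * M * ?U x" using VM[OF x] f_pos[OF x] by (simp add: field_simps)
    then have "(V x / f x)\<^sup>2 \<le> (r * M * ?U x) * (V x / f x)"
      using V0[OF x] f_pos[OF x] unfolding power2_eq_square by (intro mult_right_mono) auto
    also have "\<dots> \<le> (r * M * ?U x) * (sqrt (r * F / \<epsilon>) * ?U x / f x)"
      using Vs f_pos[OF x] r M_nonneg S0[of x] x by (intro mult_left_mono divide_right_mono) auto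
    also have "\<dots> = (r * M * sqrt (r * F / \<epsilon>) * (?U x)\<^sup>2) * (1 / f x)"
      by (simp add: power2_eq_square)
    also have "\<dots> \<le> (r * M * sqrt (r * F / \<epsilon>) * (?U x)\<^sup>2) * (?h\<^sup>2 / c)"
      using r M_nonneg F_pos eps by (intro mult_left_mono[OF fh]) auto
    also have "\<dots> = (K * ?h * ?U x)\<^sup>2"
    proof -
      have "K\<^sup>2 = M * sqrt (F / \<epsilon>) / c * (r * sqrt r)"
        unfolding K_def power_mult_distrib a2 using M_nonneg F_pos eps c_pos by simp
      moreover have "sqrt (r * F / \<epsilon>) = sqrt (F / \<epsilon>) * sqrt r"
        by (simp add: real_sqrt_mult real_sqrt_divide)
      ultimately show ?thesis by (simp add: power_mult_distrib)
    qed
    finally show "(V x / f x)\<^sup>2 \<le> (K * ?h * ?U x)\<^sup>2" .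
  qed
  \<comment> \<open>A Gronwall argument: \<open>?H\<close> is an antiderivative of
    \<open>1 / sqrt x + 1 / sqrt (pi - x)\<close>, and its increase \<open>4 * sqrt pi\<close> over
    the interval is the constant in the exponent.\<close>
  let ?H = "\<lambda>x. 2 * sqrt x - 2 * sqrt (pi - x)"
  let ?L = "\<lambda>x. ?U x * exp (- (K * ?H x))"
  have "?L pi \<le> ?L 0"
  proof (rule DERIV_nonpos_imp_decreasing_open[of 0 pi ?L])
    show "continuous_on {0..pi} ?L" by (intro continuous_intros S_cont)
    fix t :: real assume "0 < t" "t < pi"
    then have t: "t \<in> {0<..<pi}" by auto
    let ?h = "1 / sqrt t + 1 / sqrt (pi - t)"
    have "(?H has_real_derivative 2 * (inverse (sqrt t) / 2) - 2 * (inverse (sqrt (pi - t)) / 2 * (0 - 1))) (at t)"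
      by (intro DERIV_diff DERIV_cmult DERIV_real_sqrt DERIV_chain2[OF DERIV_real_sqrt] DERIV_const DERIV_ident)
        (use t in auto)
    then have "(?H has_real_derivative ?h) (at t)"
      by (rule DERIV_cong) (simp add: inverse_eq_divide)
    then have L: "(?L has_real_derivative V t / f t * exp (- (K * ?H t)) + exp (- (K * ?H t)) * (- (K * ?h)) * ?U t) (at t)"
      by (intro DERIV_mult U' t DERIV_fun_exp DERIV_minus DERIV_cmult)
    have "V t / f t * exp (- (K * ?H t)) + exp (- (K * ?H t)) * (- (K * ?h)) * ?U t =
        exp (- (K * ?H t)) * (V t / f t - K * ?h * ?U t)" by (simp add: algebra_simps)
    also have "\<dots> \<le> 0" using U'_le[OF t] by (intro mult_nonneg_nonpos) auto
    finally show "\<exists>y. (?L has_real_derivative y) (at t) \<and> y \<le> 0" using L by (intro exI conjI)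
  qed simp
  then have "?U pi * exp (- (K * (2 * sqrt pi))) \<le> exp (K * (2 * sqrt pi))" by simp
  then have "?U pi \<le> exp (K * (2 * sqrt pi)) * exp (K * (2 * sqrt pi))"
    by (simp add: exp_minus field_simps)
  then show ?thesis by (simp add: K_def a_def mult_ac flip: exp_add)
qed

lemma G_growth: "norm (G z) \<le> exp (4 * sqrt pi * sqrt (M * sqrt (F / \<epsilon>) / c) * norm z powr (3/4))"
proof (rule LIMSEQ_le_const2)
  show "(\<lambda>N. norm (S (Suc N) z pi)) \<longlonglongrightarrow> norm (G z)"
    by (intro tendsto_intros LIMSEQ_Suc S_LIMSEQ_G)
  show "\<exists>N. \<forall>n\<ge>N. norm (S (Suc n) z pi) \<le> exp (4 * sqrt pi * sqrt (M * sqrt (F / \<epsilon>) / c) * norm z powr (3/4))"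
    using norm_S_le[of pi] S_growth[of "norm z"] by (meson atLeastAtMost_iff norm_ge_zero order_refl order_trans pi_ge_zero)
qed

lemma imaginary_if_G_even: "G z = G (- z) \<Longrightarrow> Re z = 0"
  by (rule entire_symmetric_value_imp_imaginary[OF G_holomorphic G_cnj G_growth _ _ _ norm_G_ge_1 G_neg_1_neq_G_1])
    (auto simp: M_nonneg F_pos eps c_pos less_imp_le)

text \<open>The solution is compared with \<open>y0\<close> times the truncated series. The crux is
  that the flux \<open>P * f * y'\<close> tends to 0 at 0, so that both first-order equations can be
  integrated from 0; iterating leaves a remainder with a factorial in the denominator.\<close>

lemma
  fixes y Y :: "real \<Rightarrow> complex"
  assumes y': "\<And>x. x \<in> {0<..<pi} \<Longrightarrow> (y has_vector_derivative Y x / of_real (f x)) (at x)"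
    and Y': "\<And>x. x \<in> {0<..<pi} \<Longrightarrow>
      (Y has_vector_derivative (z * y x - Y x / of_real (f x)) / of_real \<epsilon>) (at x)"
    and y0: "(y \<longlongrightarrow> y0) (at_right 0)" and l: "(y \<longlongrightarrow> l) (at_left pi)"
  shows solution_limit_eq: "l = y0 * G z"
    and solution_eq_0: "y0 = 0 \<Longrightarrow> x \<in> {0<..<pi} \<Longrightarrow> y x = 0"
proof -
  have y_cont: "continuous_on {0<..<pi} y"
    using y' by (intro continuous_at_imp_continuous_on) (blast intro: has_vector_derivative_continuous)
  obtain B where B: "\<And>x. x \<in> {0<..<pi} \<Longrightarrow> norm (y x) \<le> B"
  proof -
    \<comment> \<open>Extended by its two limits, \<open>y\<close> is continuous on a compact
      interval, hence bounded.\<close>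
    let ?w = "\<lambda>x. if x = 0 then y0 else if x = pi then l else y x"
    have "continuous_on {0..pi} ?w"
    proof (rule continuous_on_IccI)
      show "(?w \<longlongrightarrow> ?w 0) (at_right 0)"
        by (rule Lim_transform_eventually[of y])
          (auto simp: y0 eventually_at_right_field intro!: exI[of _ pi])
      show "(?w \<longlongrightarrow> ?w pi) (at_left pi)"
        by (rule Lim_transform_eventually[of y])
          (auto simp: l eventually_at_left_field intro!: exI[of _ 0])
      fix x :: real assume x: "0 < x" "x < pi"
      have "isCont y x" using y_cont x by (simp add: continuous_on_eq_continuous_at)
      then have "(y \<longlongrightarrow> ?w x) (at x)" using x by (simp add: isCont_def)
      then show "(?w \<longlongrightarrow> ?w x) (at x)"
        by (rule Lim_transform_within_open[of _ _ _ _ "{0<..<pi}"]) (use x in auto)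
    qed simp
    then have "bounded (?w ` {0..pi})"
      by (intro compact_imp_bounded compact_continuous_image) auto
    then obtain B where "\<forall>x\<in>{0..pi}. norm (?w x) \<le> B" unfolding bounded_iff by blast
    then have "norm (y x) \<le> B" if "x \<in> {0<..<pi}" for x
      using that by (auto dest!: bspec[of _ _ x])
    then show ?thesis by (rule that)
  qed
  have B0: "B \<ge> 0" using B[of 1] norm_ge_zero[of "y 1"] pi_gt3
    by (simp del: norm_ge_zero)
  define Z where "Z x = of_real (P x) * Y x" for x
  have yZ: "(y has_vector_derivative Z x / of_real (P x * f x)) (at x)" if x: "x \<in> {0<..<pi}" for x
    using y'[OF x] P_pos[OF x] by (simp add: Z_def)
  have Z': "(Z has_vector_derivative z * of_real (P x / \<epsilon>) * y x) (at x)" if x: "x \<in> {0<..<pi}" for x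
  proof -
    have "((\<lambda>x. of_real (P x) * Y x) has_vector_derivative
        of_real (P x) * ((z * y x - Y x / of_real (f x)) / of_real \<epsilon>) + of_real (P x / (\<epsilon> * f x)) * Y x) (at x)"
      by (intro has_vector_derivative_mult has_vector_derivative_of_real P_deriv Y' x)
    moreover have "of_real (P x) * ((z * y x - Y x / of_real (f x)) / of_real \<epsilon>) + of_real (P x / (\<epsilon> * f x)) * Y x =
        z * of_real (P x / \<epsilon>) * y x"
      using f_pos[OF x] eps by (simp add: field_simps)
    ultimately show ?thesis by (simp add: Z_def[abs_def])
  qed

  obtain k where Zk: "(Z \<longlongrightarrow> k) (at_right 0)"
  proof -
    \<comment> \<open>Near 0 the derivative of \<open>Z\<close> is bounded, as \<open>P\<close> is
      increasing and \<open>y\<close> bounded, so \<open>Z\<close> is a constant plus an integral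
      that is continuous at 0. The interval \<open>{0<..<1}\<close> stays away from
      \<open>pi\<close>.\<close>
    let ?g = "\<lambda>x. z * of_real (P x / \<epsilon>) * y x"
    have gc: "continuous_on {0<..<1} ?g"
      using pi_gt3 eps by (intro continuous_intros continuous_on_subset[OF P_cont] continuous_on_subset[OF y_cont]) auto
    have gb: "norm (?g x) \<le> norm z * (P 1 / \<epsilon>) * B" if x: "x \<in> {0<..<1}" for x
    proof -
      have x': "x \<in> {0<..<pi}" using x pi_gt3 by auto
      have "norm (?g x) = norm z * (P x / \<epsilon>) * norm (y x)"
        using P_pos[OF x'] eps by (simp add: norm_mult norm_divide)
      also have "\<dots> \<le> norm z * (P 1 / \<epsilon>) * B"
        using B[OF x'] B0 P_mono[of x 1] P_pos[OF x'] x pi_gt3 eps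
        by (intro mult_mono mult_nonneg_nonneg divide_right_mono) auto
      finally show ?thesis .
    qed
    let ?I = "\<lambda>x. integral {0..x} ?g"
    have "((\<lambda>x. Z x - ?I x) has_vector_derivative 0) (at x within {0<..<1})" if x: "x \<in> {0<..<1}" for x
      using has_vector_derivative_diff[OF Z' has_vector_derivative_indefinite_integral_bounded[OF gc gb x]] x pi_gt3
      by (auto intro: has_vector_derivative_at_within)
    then obtain k where k: "\<And>x. x \<in> {0<..<1} \<Longrightarrow> Z x - ?I x = k"
      using has_vector_derivative_zero_constant[of "{0<..<1::real}" "\<lambda>x. Z x - ?I x"] by auto
    have "(?I \<longlongrightarrow> ?I 0) (at_right 0)"
      using continuous_on_Icc_at_rightD[OF continuous_on_indefinite_integral_bounded[OF gc gb] zero_less_one] by simp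
    from tendsto_add[OF tendsto_const this, of k] have "((\<lambda>x. k + ?I x) \<longlongrightarrow> k) (at_right 0)"
      by simp
    then have "(Z \<longlongrightarrow> k) (at_right 0)"
    proof (rule Lim_transform_eventually)
      show "\<forall>\<^sub>F x in at_right 0. k + ?I x = Z x"
        using k by (auto simp: eventually_at_right_field algebra_simps intro!: exI[of _ 1])
    qed
    then show ?thesis by (rule that)
  qed
  \<comment> \<open>otherwise \<open>y\<close> would have a logarithmic singularity at \<open>0\<close>, or a stronger one\<close>
  have "k = 0"
  proof (rule ccontr)
    assume k0: "k \<noteq> 0"
    \<comment> \<open>Near 0 the real part of \<open>cnj k * Z\<close> exceeds half its limit
      \<open>(norm k)\<^sup>2\<close>, and \<open>P t * f t \<le> P 1 * (F * t)\<close>. So the real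
      part of \<open>cnj k * y\<close> has derivative at least \<open>m / t\<close> and falls to
      minus infinity like \<open>m * ln t\<close> or faster, against the bound
      \<open>B\<close>.\<close>
    define m where "m = (norm k)\<^sup>2 / 2 / (P 1 * F)"
    have P1: "P 1 > 0" using P_pos[of 1] pi_gt3 by simp
    have m: "m > 0" using k0 P1 F_pos by (simp add: m_def)
    have "((\<lambda>x. Re (cnj k * Z x)) \<longlongrightarrow> Re (cnj k * k)) (at_right 0)"
      by (intro tendsto_intros Zk)
    moreover have "(norm k)\<^sup>2 / 2 < Re (cnj k * k)"
      unfolding mult.commute[of "cnj k"] complex_norm_square[symmetric] Re_complex_of_real using k0 by simp
    ultimately have "\<forall>\<^sub>F x in at_right 0. (norm k)\<^sup>2 / 2 < Re (cnj k * Z x)"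
      by (rule order_tendstoD)
    then obtain b where b: "b > 0" "\<And>x. 0 < x \<Longrightarrow> x < b \<Longrightarrow> (norm k)\<^sup>2 / 2 < Re (cnj k * Z x)"
      by (auto simp: eventually_at_right_field)
    define x0 where "x0 = min (b/2) 1"
    have x0: "x0 > 0" "x0 < b" "x0 \<le> 1" using b by (auto simp: x0_def)
    let ?\<psi> = "\<lambda>x. Re (cnj k * y x) - m * ln x"
    have mono: "?\<psi> x \<le> ?\<psi> x0" if x: "0 < x" "x \<le> x0" for x
    proof (rule DERIV_nonneg_imp_nondecreasing[OF x(2)])
      fix t assume "x \<le> t" "t \<le> x0"
      then have t: "0 < t" "t < b" "t \<le> 1" "t \<in> {0<..<pi}" using x x0 pi_gt3 by auto
      have "(?\<psi> has_real_derivative Re (cnj k * (Z t / of_real (P t * f t))) - m * (1 / t)) (at t)"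
        unfolding has_real_derivative_iff_has_vector_derivative
        by (intro has_vector_derivative_diff bounded_linear.has_vector_derivative[OF bounded_linear_Re]
            has_vector_derivative_mult_right yZ t)
          (use t in \<open>auto simp flip: has_real_derivative_iff_has_vector_derivative intro!: derivative_eq_intros\<close>)
      moreover have "m * (1 / t) \<le> Re (cnj k * (Z t / of_real (P t * f t)))"
      proof -
        have re: "Re (w / of_real a) = Re w / a" for w a by simp
        have "P t * f t \<le> P 1 * (F * t)"
          using P_mono[of t 1] f_le_lin[OF t(4)] P1 f_pos[OF t(4)] t pi_gt3 by (intro mult_mono) auto
        then have "(norm k)\<^sup>2 / 2 / (P 1 * (F * t)) \<le> (norm k)\<^sup>2 / 2 / (P t * f t)"
          using P1 F_pos t P_pos[OF t(4)] f_pos[OF t(4)] by (intro divide_left_mono mult_pos_pos) auto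
        also have "\<dots> \<le> Re (cnj k * Z t) / (P t * f t)"
          using b(2)[OF t(1,2)] Pf_pos[OF t(4)] by (intro divide_right_mono) auto
        finally show ?thesis by (simp only: re times_divide_eq_right m_def) (simp add: mult_ac)
      qed
      ultimately show "\<exists>d. (?\<psi> has_real_derivative d) (at t) \<and> 0 \<le> d"
        by (intro exI conjI) auto
    qed
    have "\<forall>\<^sub>F x in at_right 0. ln x < (- (norm k * B) - ?\<psi> x0) / m"
      using ln_at_0 by (simp add: filterlim_at_bot_dense)
    then obtain d where d: "d > 0" "\<And>x. 0 < x \<Longrightarrow> x < d \<Longrightarrow> ln x < (- (norm k * B) - ?\<psi> x0) / m"
      by (auto simp: eventually_at_right_field)
    define x where "x = min (d/2) x0"
    have x: "0 < x" "x < d" "x \<le> x0" "x \<in> {0<..<pi}" using d x0 pi_gt3 by (auto simp: x_def)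
    have "- (norm k * B) \<le> Re (cnj k * y x)"
    proof -
      have "norm (cnj k * y x) \<le> norm k * B" using B[OF x(4)] by (simp add: norm_mult mult_left_mono)
      then show ?thesis using abs_Re_le_cmod[of "cnj k * y x"] by linarith
    qed
    moreover have "m * ln x < - (norm k * B) - ?\<psi> x0" using d(2)[OF x(1,2)] m by (simp add: field_simps)
    ultimately show False using mono[OF x(1,3)] by linarith
  qed
  then have Z0: "(Z \<longlongrightarrow> 0) (at_right 0)" using Zk by simp

  let ?L = "norm z * M"
  have remainder: "norm (y x - y0 * S N z x) \<le> B * ((?L * x) ^ N / fact N)" if "x \<in> {0<..<pi}" for x N
    using that
  proof (induction N arbitrary: x)
    case 0
    then show ?case using B by (simp add: S_def)
  next
    case (Suc N)
    define C where "C = norm z * B * (?L ^ N / fact N)"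
    have C0: "C \<ge> 0" using B0 M_nonneg by (simp add: C_def)
    have ZE: "norm (Z t - y0 * E N z t) \<le> C * (t ^ N * R t)" if t: "t \<in> {0<..<pi}" for t
    proof -
      \<comment> \<open>The derivative of the majorant \<open>C * (t ^ N * R t)\<close> contains
        \<open>C * t ^ N * P t / \<epsilon>\<close>, the bound from the induction hypothesis, plus a
        nonnegative term.\<close>
      have "norm (Z t - y0 * E N z t - 0) \<le> C * (t ^ N * R t) - 0"
      proof (rule norm_diff_le_of_derivative_bound[OF _ _ _ _ _ t])
        show "((\<lambda>t. Z t - y0 * E N z t) \<longlongrightarrow> 0) (at_right 0)" "((\<lambda>t. C * (t ^ N * R t)) \<longlongrightarrow> 0) (at_right 0)"
          by (rule tendsto_eq_intros Z0 E_lim R_lim refl | simp)+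
        fix s assume s: "s \<in> {0<..<pi}"
        let ?p' = "z * of_real (P s / \<epsilon>) * y s - y0 * (z * of_real (P s / \<epsilon>) * S N z s)"
        let ?q' = "C * (s ^ N * (P s / \<epsilon>) + real N * s ^ (N - 1) * R s)"
        show "((\<lambda>t. Z t - y0 * E N z t) has_vector_derivative ?p') (at s)"
          by (intro has_vector_derivative_diff has_vector_derivative_mult_right Z' E_deriv s)
        show "((\<lambda>t. C * (t ^ N * R t)) has_real_derivative ?q') (at s)"
          by (intro DERIV_cmult DERIV_mult' R_deriv s) (use DERIV_pow[of N s] in simp)
        have "?p' = z * of_real (P s / \<epsilon>) * (y s - y0 * S N z s)" by (simp add: algebra_simps)
        then have "norm ?p' = norm z * (P s / \<epsilon>) * norm (y s - y0 * S N z s)"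
          using P_pos[OF s] eps by (simp add: norm_mult norm_divide)
        also have "\<dots> \<le> norm z * (P s / \<epsilon>) * (B * ((?L * s) ^ N / fact N))"
          using P_pos[OF s] eps by (intro mult_left_mono Suc.IH[OF s]) auto
        also have "\<dots> = C * (s ^ N * (P s / \<epsilon>))" by (simp add: C_def power_mult_distrib mult_ac)
        also have "\<dots> \<le> ?q'" using C0 R_nonneg[OF s] s by (intro mult_left_mono) auto
        finally show "norm ?p' \<le> ?q'" .
      qed
      then show ?thesis by simp
    qed
    have "norm (y x - y0 * S (Suc N) z x - 0) \<le> C * M * (x ^ Suc N / real (Suc N)) - 0"
    proof (rule norm_diff_le_of_derivative_bound[OF _ _ _ _ _ Suc.prems])
      show "((\<lambda>x. y x - y0 * S (Suc N) z x) \<longlongrightarrow> 0) (at_right 0)"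
        by (rule tendsto_eq_intros y0 S_lim refl | simp)+
      show "((\<lambda>x. C * M * (x ^ Suc N / real (Suc N))) \<longlongrightarrow> 0) (at_right 0)"
        by (rule tendsto_eq_intros refl | simp del: of_nat_Suc)+
      fix s assume s: "s \<in> {0<..<pi}"
      let ?p' = "Z s / of_real (P s * f s) - y0 * (E N z s / of_real (P s * f s))"
      show "((\<lambda>x. y x - y0 * S (Suc N) z x) has_vector_derivative ?p') (at s)"
        by (intro has_vector_derivative_diff has_vector_derivative_mult_right yZ S_deriv s)
      show "((\<lambda>x. C * M * (x ^ Suc N / real (Suc N))) has_real_derivative C * M * s ^ N) (at s)"
        by (rule derivative_eq_intros refl | simp)+
      have "?p' = (Z s - y0 * E N z s) / of_real (P s * f s)" by (simp add: diff_divide_distrib)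
      then have "norm ?p' = norm (Z s - y0 * E N z s) / (P s * f s)"
        using Pf_pos[OF s] by (simp only: norm_divide norm_of_real abs_of_pos)
      also have "\<dots> \<le> C * (s ^ N * R s) / (P s * f s)"
        using Pf_pos[OF s] ZE[OF s] by (intro divide_right_mono) auto
      also have "\<dots> \<le> C * (s ^ N * (M * (P s * f s))) / (P s * f s)"
        using Pf_pos[OF s] C0 s R_le[OF s] by (intro divide_right_mono mult_left_mono) auto
      also have "\<dots> = C * M * s ^ N" using P_pos[OF s] f_pos[OF s] by simp
      finally show "norm ?p' \<le> C * M * s ^ N" .
    qed
    also have "\<dots> = B * ((?L * x) ^ Suc N / fact (Suc N))"
      by (simp add: C_def power_mult_distrib mult_ac)
    finally show ?case by simp
  qed
  have bound: "norm (l - y0 * S N z pi) \<le> B * ((?L * pi) ^ N / fact N)" for N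
  proof (rule tendsto_le)
    show "((\<lambda>x. norm (y x - y0 * S N z x)) \<longlongrightarrow> norm (l - y0 * S N z pi)) (at_left pi)"
      by (intro tendsto_intros l continuous_on_Icc_at_leftD[OF S_cont]) simp
    show "((\<lambda>x. B * ((?L * x) ^ N / fact N)) \<longlongrightarrow> B * ((?L * pi) ^ N / fact N)) (at_left pi)"
      by (intro tendsto_intros) auto
    show "\<forall>\<^sub>F x in at_left pi. norm (y x - y0 * S N z x) \<le> B * ((?L * x) ^ N / fact N)"
      using remainder by (auto simp: eventually_at_left_field intro!: exI[of _ 0])
  qed simp
  have lim: "(\<lambda>N. B * ((?L * x) ^ N / fact N)) \<longlonglongrightarrow> 0" for x
  proof -
    have "(\<lambda>N. B * (inverse (fact N) * (?L * x) ^ N)) \<longlonglongrightarrow> B * 0"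
      by (intro tendsto_intros summable_LIMSEQ_zero summable_exp)
    then show ?thesis unfolding divide_inverse_commute mult_zero_right .
  qed
  have "(\<lambda>N. l - y0 * S N z pi) \<longlonglongrightarrow> 0"
    by (rule Lim_null_comparison[OF _ lim[of pi]]) (intro always_eventually allI bound)
  from LIMSEQ_unique[OF this tendsto_diff[OF tendsto_const tendsto_mult[OF tendsto_const S_LIMSEQ_G]]]
  show "l = y0 * G z" by simp
  assume "y0 = 0" "x \<in> {0<..<pi}"
  then have "norm (y x) \<le> B * ((?L * x) ^ N / fact N)" for N
    using remainder[of x N] by simp
  then have "norm (y x) \<le> 0"
    by (intro LIMSEQ_le_const[OF lim]) blast
  then show "y x = 0" by simp
qed

end

subsection \<open>Reality of the eigenvalues\<close>

text \<open>\<open>P\<close> is the exponential of an antiderivative of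
  \<open>1 / (\<epsilon> * f)\<close>; the work lies in \<open>R_le\<close>. Up to \<open>b\<close>
  it follows from \<open>R x \<le> x * P x / \<epsilon>\<close> and the lower bound on
  \<open>f\<close>. Beyond \<open>b\<close>, \<open>f x \<le> d * (pi - x)\<close> makes
  \<open>P\<close> grow at least like a power of \<open>1 / (pi - x)\<close> with exponent
  \<open>1 / (d * \<epsilon>) > 1\<close>, so its primitive is at most of the size of
  \<open>P x * (pi - x)\<close>.\<close>

lemma singular_ode_exists:
  fixes f :: "real \<Rightarrow> real"
  assumes eps: "\<epsilon> > 0" and f_cont: "continuous_on {0<..<pi} f"
    and f_pos: "\<And>x. x \<in> {0<..<pi} \<Longrightarrow> f x > 0"
    and f_le: "\<And>x. x \<in> {0<..<pi} \<Longrightarrow> f x \<le> F" "\<And>x. x \<in> {0<..<pi} \<Longrightarrow> f x \<le> F * x"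
    and c: "c > 0" "\<And>x. x \<in> {0<..<pi} \<Longrightarrow> c * min x (pi - x) \<le> f x"
    and b: "pi / 2 \<le> b" "b < pi" and d: "d > 0" "d * \<epsilon> < 1"
    and f_le_d: "\<And>x. x \<in> {b..<pi} \<Longrightarrow> f x \<le> d * (pi - x)"
  obtains P R M where "singular_ode f P R \<epsilon> M F c"
proof -
  have b': "b \<in> {0<..<pi}" using b pi_gt3 by auto
  have "isCont (\<lambda>x. 1 / (\<epsilon> * f x)) x" if "ereal 0 < ereal x" "ereal x < ereal pi" for x
    using that f_cont f_pos[of x] eps by (intro continuous_intros) (auto simp: continuous_on_eq_continuous_at)
  then obtain A where A: "\<And>x. 0 < x \<Longrightarrow> x < pi \<Longrightarrow> (A has_real_derivative 1 / (\<epsilon> * f x)) (at x)"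
    using einterval_antiderivative[of "ereal 0" "ereal pi" "\<lambda>x. 1 / (\<epsilon> * f x)"]
    by (auto simp: has_real_derivative_iff_has_vector_derivative)
  define P where "P x = exp (A x)" for x
  have P_pos: "P x > 0" for x by (simp add: P_def)
  have P_deriv: "(P has_real_derivative P x / (\<epsilon> * f x)) (at x)" if x: "x \<in> {0<..<pi}" for x
    using DERIV_fun_exp[OF A[of x]] x by (simp add: P_def[abs_def])
  have P_cont: "continuous_on {0<..<pi} P"
    using P_deriv DERIV_isCont by (blast intro: continuous_at_imp_continuous_on)
  have P_mono: "P x \<le> P y" if "0 < x" "x \<le> y" "y < pi" for x y
  proof (rule DERIV_nonneg_imp_nondecreasing[OF that(2)])
    fix t assume "x \<le> t" "t \<le> y"
    then have t: "t \<in> {0<..<pi}" using that by auto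
    show "\<exists>d. (P has_real_derivative d) (at t) \<and> 0 \<le> d"
      using P_deriv[OF t] P_pos[of t] f_pos[OF t] eps by (intro exI conjI) auto
  qed
  define R where "R x = integral {0..x} (\<lambda>t. P t / \<epsilon>)" for x
  have g_cont: "continuous_on {0<..<a} (\<lambda>t. P t / \<epsilon>)" if "a < pi" for a
    using that eps by (intro continuous_intros continuous_on_subset[OF P_cont]) auto
  have g_bound: "norm (P x / \<epsilon>) \<le> P a / \<epsilon>" if "a < pi" "x \<in> {0<..<a}" for a x
    using that eps P_mono[of x a] P_pos[of x] by (auto intro!: divide_right_mono)
  have R_deriv: "(R has_real_derivative P x / \<epsilon>) (at x)" if x: "x \<in> {0<..<pi}" for x
  proof -
    obtain a where a: "x < a" "a < pi" using x by (metis dense greaterThanLessThan_iff)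
    show ?thesis
      using has_vector_derivative_indefinite_integral_bounded[OF g_cont[OF a(2)] g_bound[OF a(2)], of x] x a
      by (simp add: R_def[abs_def] has_real_derivative_iff_has_vector_derivative)
  qed
  have "continuous_on {0..1} R"
    using continuous_on_indefinite_integral_bounded[OF g_cont[of 1] g_bound[of 1]] pi_gt3
    by (simp add: R_def[abs_def])
  from continuous_on_Icc_at_rightD[OF this zero_less_one]
  have R_lim: "(R \<longlongrightarrow> 0) (at_right 0)" by (simp add: R_def)
  have R_nonneg: "0 \<le> R x" if x: "x \<in> {0<..<pi}" for x
    by (rule ge_limit_of_derivative_nonneg[OF R_deriv _ R_lim x]) (use P_pos eps in \<open>auto simp: less_imp_le\<close>)
  have R_le: "R x \<le> x * P x / \<epsilon>" if x: "x \<in> {0<..<pi}" for x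
  proof -
    let ?k = "\<lambda>x. x * P x / \<epsilon> - R x"
    have "0 \<le> ?k x"
    proof (rule ge_limit_of_derivative_nonneg[OF _ _ _ x])
      have "((\<lambda>x. x * P x) \<longlongrightarrow> 0) (at_right 0)"
      proof (rule tendsto_sandwich)
        show "\<forall>\<^sub>F x in at_right 0. 0 \<le> x * P x"
          using P_pos by (auto simp: eventually_at_right_field less_imp_le intro!: exI[of _ 1])
        show "\<forall>\<^sub>F x in at_right 0. x * P x \<le> x * P 1"
          using P_mono[of _ 1] pi_gt3 by (auto simp: eventually_at_right_field intro!: exI[of _ 1])
        show "((\<lambda>x. x * P 1) \<longlongrightarrow> 0) (at_right 0)" by (rule tendsto_eq_intros refl | simp)+
      qed simp
      then have "((\<lambda>x. x * P x / \<epsilon> - R x) \<longlongrightarrow> 0 / \<epsilon> - 0) (at_right 0)"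
        by (intro tendsto_diff tendsto_divide R_lim) (use eps in auto)
      then show "((\<lambda>x. x * P x / \<epsilon> - R x) \<longlongrightarrow> 0) (at_right 0)" by simp
      fix t assume t: "t \<in> {0<..<pi}"
      show "(?k has_real_derivative (t * (P t / (\<epsilon> * f t)) + 1 * P t) / \<epsilon> - P t / \<epsilon>) (at t)"
        by (intro DERIV_diff DERIV_cdivide DERIV_mult' DERIV_ident P_deriv R_deriv t)
      show "0 \<le> (t * (P t / (\<epsilon> * f t)) + 1 * P t) / \<epsilon> - P t / \<epsilon>"
        using P_pos[of t] f_pos[OF t] eps t by (simp add: add_divide_distrib)
    qed
    then show ?thesis by simp
  qed
  have near_0: "R x \<le> pi / (\<epsilon> * c * (pi - b)) * (P x * f x)" if x: "x \<in> {0<..<pi}" "x \<le> b" for x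
  proof -
    have "x * (pi - b) / pi \<le> min x (pi - x)"
    proof -
      have "x * (pi - b) \<le> x * pi" "x * (pi - b) \<le> pi * (pi - x)"
        using x b by (intro mult_left_mono mult_mono; simp)+
      then show ?thesis by (simp add: field_simps)
    qed
    then have "c * (x * (pi - b) / pi) \<le> f x"
      using c(2)[OF x(1)] c(1) mult_left_mono[of "x * (pi - b) / pi" "min x (pi - x)" c] by linarith
    then have "x \<le> pi / (c * (pi - b)) * f x" using c b by (simp add: field_simps)
    then have "x * (P x / \<epsilon>) \<le> pi / (c * (pi - b)) * f x * (P x / \<epsilon>)"
      using P_pos[of x] eps by (intro mult_right_mono) auto
    then show ?thesis using R_le[OF x(1)] by (simp add: mult_ac)
  qed
  \<comment> \<open>near \<open>\<pi>\<close>, \<open>d * \<epsilon> < 1\<close> makes \<open>P x * (pi - x)\<close> grow at least as fast as a multiple of \<open>R\<close>\<close>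
  define \<gamma> where "\<gamma> = (1 / (\<epsilon> * d) - 1) * \<epsilon>"
  have \<gamma>: "\<gamma> > 0" using eps d by (simp add: \<gamma>_def field_simps)
  let ?S = "\<lambda>x. P x * (pi - x)"
  have S_deriv: "(?S has_real_derivative P t * (0 - 1) + P t / (\<epsilon> * f t) * (pi - t)) (at t)"
    if "t \<in> {0<..<pi}" for t
    by (intro DERIV_mult' DERIV_diff DERIV_const DERIV_ident P_deriv that)
  have S_deriv_ge: "P t / \<epsilon> * \<gamma> \<le> P t * (0 - 1) + P t / (\<epsilon> * f t) * (pi - t)" if t: "t \<in> {b..<pi}" for t
  proof -
    have ft: "f t > 0" using f_pos[of t] t b' by auto
    have "1 / (\<epsilon> * d) \<le> (pi - t) / (\<epsilon> * f t)"
      using f_le_d[OF t] ft eps d t by (simp add: field_simps)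
    then have "P t * (1 / (\<epsilon> * d) - 1) \<le> P t * ((pi - t) / (\<epsilon> * f t) - 1)"
      using P_pos[of t] by (intro mult_left_mono) auto
    moreover have "P t / \<epsilon> * \<gamma> = P t * (1 / (\<epsilon> * d) - 1)" using eps by (simp add: \<gamma>_def)
    moreover have "P t * (0 - 1) + P t / (\<epsilon> * f t) * (pi - t) = P t * ((pi - t) / (\<epsilon> * f t) - 1)"
      by (simp add: right_diff_distrib diff_divide_distrib)
    ultimately show ?thesis by simp
  qed
  \<comment> \<open>\<open>R x - R b\<close> is at most \<open>?S x / \<gamma>\<close>, and
    \<open>R b\<close> is at most \<open>R b / ?S b * ?S x\<close>; \<open>C\<close> collects the
    two factors.\<close>
  define C where "C = R b / ?S b + 1 / \<gamma>"
  have Sb: "?S b > 0" using P_pos[of b] b by simp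
  have near_pi: "R x \<le> C / c * (P x * f x)" if x: "x \<in> {b..<pi}" for x
  proof -
    have x': "b \<le> x" "x < pi" using x by auto
    have "?S b \<le> ?S x"
    proof (rule DERIV_nonneg_imp_nondecreasing[OF x'(1)])
      fix t assume "b \<le> t" "t \<le> x"
      then have t: "t \<in> {b..<pi}" "t \<in> {0<..<pi}" using x' b' by auto
      have "0 \<le> P t / \<epsilon> * \<gamma>" using P_pos[of t] eps \<gamma> by simp
      then show "\<exists>y. (?S has_real_derivative y) (at t) \<and> 0 \<le> y"
        using S_deriv[OF t(2)] order_trans[OF _ S_deriv_ge[OF t(1)]] by blast
    qed
    then have "R b * ?S b \<le> R b * ?S x" by (intro mult_left_mono R_nonneg b')
    then have 1: "R b \<le> R b / ?S b * ?S x" using Sb by (simp add: field_simps)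
    have "?S b / \<gamma> - R b \<le> ?S x / \<gamma> - R x"
    proof (rule DERIV_nonneg_imp_nondecreasing[OF x'(1)])
      fix t assume "b \<le> t" "t \<le> x"
      then have t: "t \<in> {b..<pi}" "t \<in> {0<..<pi}" using x' b' by auto
      let ?D = "(P t * (0 - 1) + P t / (\<epsilon> * f t) * (pi - t)) / \<gamma> - P t / \<epsilon>"
      have "((\<lambda>x. ?S x / \<gamma> - R x) has_real_derivative ?D) (at t)"
        by (intro DERIV_diff DERIV_cdivide S_deriv R_deriv t)
      moreover have "0 \<le> ?D"
        using divide_right_mono[OF S_deriv_ge[OF t(1)], of \<gamma>] \<gamma> by simp
      ultimately show "\<exists>y. ((\<lambda>x. ?S x / \<gamma> - R x) has_real_derivative y) (at t) \<and> 0 \<le> y" by blast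
    qed
    moreover have "0 \<le> ?S b / \<gamma>" using Sb \<gamma> by (intro divide_nonneg_pos) auto
    ultimately have R1: "R x \<le> C * ?S x" using 1 by (simp add: C_def distrib_right)
    have "min x (pi - x) = pi - x" using x b by auto
    then have "c * (pi - x) \<le> f x" using c(2)[of x] x b' by auto
    then have "pi - x \<le> f x / c" using c(1) by (simp add: field_simps)
    moreover have "0 \<le> C * P x" using R_nonneg[OF b'] Sb \<gamma> P_pos[of x] by (simp add: C_def)
    ultimately have "C * P x * (pi - x) \<le> C * P x * (f x / c)" by (rule mult_left_mono)
    then show ?thesis using R1 by (simp add: mult_ac)
  qed
  let ?M = "max (pi / (\<epsilon> * c * (pi - b))) (C / c)"
  have "singular_ode f P R \<epsilon> ?M F c"
  proof
    fix x assume x: "x \<in> {0<..<pi}"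
    have Pf: "0 \<le> P x * f x" using P_pos[of x] f_pos[OF x] by simp
    show "R x \<le> ?M * (P x * f x)"
    proof (cases "x \<le> b")
      case True
      show ?thesis
        using near_0[OF x True] mult_right_mono[OF max.cobounded1 Pf] by (rule order_trans)
    next
      case False
      then have "x \<in> {b..<pi}" using x by auto
      from near_pi[OF this] mult_right_mono[OF max.cobounded2 Pf] show ?thesis by (rule order_trans)
    qed
  qed (use assms P_pos P_deriv R_lim R_deriv in auto)
  then show ?thesis by (rule that)
qed

text \<open>The symmetries give \<open>f (pi - x) = f x\<close>, which reduces everything to
  \<open>{0..pi/2}\<close>. There \<open>f x / x\<close>, with value \<open>D\<close> at 0, is
  continuous and positive, hence lies between positive constants.\<close>

lemma odd_antiperiodic_bounds:
  fixes f :: "real \<Rightarrow> real"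
  assumes cont: "continuous_on UNIV f" and antiper: "\<And>x. f (x + pi) = - f x"
    and odd: "\<And>x. f (- x) = - f x" and pos: "\<And>x. x \<in> {0<..<pi} \<Longrightarrow> f x > 0"
    and deriv: "(f has_real_derivative D) (at 0)" and D: "D > 0"
  obtains c F where "c > 0" "\<And>x. x \<in> {0<..<pi} \<Longrightarrow> c * min x (pi - x) \<le> f x"
    "\<And>x. x \<in> {0<..<pi} \<Longrightarrow> f x \<le> F" "\<And>x. x \<in> {0<..<pi} \<Longrightarrow> f x \<le> F * x"
proof -
  have f0: "f 0 = 0" using odd[of 0] by simp
  have refl: "f (pi - x) = f x" for x using antiper[of "- x"] odd[of x] by (simp add: add.commute)
  define g where "g x = (if x = 0 then D else f x / x)" for x
  have g_lim: "(g \<longlongrightarrow> g 0) (at 0)"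
  proof (rule Lim_transform_eventually)
    show "((\<lambda>x. f x / x) \<longlongrightarrow> g 0) (at 0)" using deriv f0 by (simp add: has_field_derivative_iff g_def)
    show "\<forall>\<^sub>F x in at 0. f x / x = g x" by (auto simp: eventually_at_filter g_def)
  qed
  have "isCont g x" for x
  proof (cases "x = 0")
    case False
    have "isCont (\<lambda>x. f x / x) x"
      using cont False by (intro continuous_intros) (auto simp: continuous_on_eq_continuous_at)
    then have "((\<lambda>x. f x / x) \<longlongrightarrow> g x) (at x)" using False by (simp add: isCont_def g_def)
    then show ?thesis unfolding isCont_def
      by (rule Lim_transform_within_open[of _ _ _ _ "- {0}"]) (use False in \<open>auto simp: g_def\<close>)
  qed (use g_lim in \<open>simp add: isCont_def\<close>)
  then have gc: "continuous_on {0..pi/2} g" by (simp add: continuous_at_imp_continuous_on)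
  have ne: "{0..pi/2} \<noteq> {}" by simp
  obtain p where p: "p \<in> {0..pi/2}" "\<And>x. x \<in> {0..pi/2} \<Longrightarrow> g p \<le> g x"
    using continuous_attains_inf[OF compact_Icc ne gc] by blast
  obtain q where q: "q \<in> {0..pi/2}" "\<And>x. x \<in> {0..pi/2} \<Longrightarrow> g x \<le> g q"
    using continuous_attains_sup[OF compact_Icc ne gc] by blast
  have gp: "g p > 0" using p(1) pos[of p] D pi_gt3 by (auto simp: g_def)
  then have gq: "g q > 0" using q(2)[OF p(1)] by linarith
  have half: "g p * x \<le> f x" "f x \<le> g q * x" if "0 < x" "x \<le> pi / 2" for x
    using p(2)[of x] q(2)[of x] that by (auto simp: g_def field_simps)
  have *: "g p * min x (pi - x) \<le> f x" "f x \<le> g q * min x (pi - x)" if x: "x \<in> {0<..<pi}" for x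
    using half[of x] half[of "pi - x"] x refl[of x] by (auto simp: min_def)
  show ?thesis
  \<comment> \<open>The factor \<open>pi\<close> serves both upper bounds:
    \<open>min x (pi - x)\<close> is at most \<open>pi\<close> and, as \<open>pi > 1\<close>, at
    most \<open>pi * x\<close>.\<close>
  proof (rule that[of "g p" "g q * pi"])
    fix x assume x: "x \<in> {0<..<pi}"
    show "g p * min x (pi - x) \<le> f x" by (rule *(1)[OF x])
    have "g q * min x (pi - x) \<le> g q * pi" "g q * min x (pi - x) \<le> g q * pi * x"
    proof -
      show "g q * min x (pi - x) \<le> g q * pi" using gq x by (intro mult_left_mono) auto
      have "1 * x \<le> pi * x" using x pi_gt3 by (intro mult_right_mono) auto
      then have "min x (pi - x) \<le> pi * x" by linarith
      then show "g q * min x (pi - x) \<le> g q * pi * x" using gq by (simp add: mult.assoc)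
    qed
    then show "f x \<le> g q * pi" "f x \<le> g q * pi * x" using *(2)[OF x] by linarith+
  qed (rule gp)
qed

text \<open>Where \<open>f\<close> is nonzero, the derivatives given almost everywhere are
  continuous expressions in \<open>u\<close>, \<open>v\<close> and \<open>f\<close>, so local
  absolute continuity makes them derivatives at every point.\<close>

lemma ode_solution_classical:
  assumes sol: "ode_solution f \<epsilon> lam u" and eps: "\<epsilon> > 0" and cont: "continuous_on UNIV f"
    and nz: "\<And>x. x \<in> {-pi<..<0} \<union> {0<..<pi} \<Longrightarrow> f x \<noteq> 0"
  obtains v where
    "\<And>x. x \<in> {-pi<..<0} \<union> {0<..<pi} \<Longrightarrow> (u has_vector_derivative v x / of_real (f x)) (at x)"
    "\<And>x. x \<in> {-pi<..<0} \<union> {0<..<pi} \<Longrightarrow>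
      (v has_vector_derivative (- \<i> * lam * u x - v x / of_real (f x)) / of_real \<epsilon>) (at x)"
proof -
  let ?I = "{-pi<..<0} \<union> {0<..<pi}"
  have I: "open ?I" by auto
  let ?Q = "\<lambda>v x. \<exists>u' v'. (u has_vector_derivative u') (at x) \<and> v x = of_real (f x) * u' \<and>
                   (v has_vector_derivative v') (at x) \<and>
                   \<i> * of_real \<epsilon> * v' + \<i> * u' = lam * u x"
  obtain v where lu: "locally_absolutely_continuous_on u ?I"
    and lv: "locally_absolutely_continuous_on v ?I"
    and ae: "AE x in lebesgue. x \<in> ?I \<longrightarrow> ?Q v x"
    using sol unfolding ode_solution_def by blast
  obtain N where N': "{x \<in> space lebesgue. \<not> (x \<in> ?I \<longrightarrow> ?Q v x)} \<subseteq> N"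
    and N: "emeasure lebesgue N = 0" "N \<in> sets lebesgue"
    by (rule AE_E[OF ae])
  have eq: "?Q v x" if "x \<in> ?I - N" for x
  proof (rule ccontr)
    assume "\<not> ?Q v x"
    then have "x \<in> {x \<in> space lebesgue. \<not> (x \<in> ?I \<longrightarrow> ?Q v x)}"
      using that by (intro CollectI conjI) auto
    then show False using N' that by (meson DiffD2 subsetD)
  qed
  have neg: "negligible N" using N by (simp add: negligible_iff_null_sets null_setsI)
  have uc: "continuous_on ?I u" and vc: "continuous_on ?I v"
    using locally_absolutely_continuous_imp_continuous_on I lu lv by blast+
  have fc: "continuous_on ?I f" using cont continuous_on_subset by blast
  have du: "(u has_vector_derivative v x / of_real (f x)) (at x)" if x: "x \<in> ?I" for x
  proof (rule has_vector_derivative_locally_absolutely_continuous[OF lu I _ neg _ x])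
    show "continuous_on ?I (\<lambda>x. v x / of_real (f x))"
      using nz by (intro continuous_intros vc fc) auto
    fix t assume t: "t \<in> ?I - N"
    then show "(u has_vector_derivative v t / of_real (f t)) (at t)" using eq[OF t] nz[of t] by auto
  qed
  have dv: "(v has_vector_derivative (- \<i> * lam * u x - v x / of_real (f x)) / of_real \<epsilon>) (at x)" if x: "x \<in> ?I" for x
  proof (rule has_vector_derivative_locally_absolutely_continuous[OF lv I _ neg _ x])
    show "continuous_on ?I (\<lambda>x. (- \<i> * lam * u x - v x / of_real (f x)) / of_real \<epsilon>)"
      using nz eps by (intro continuous_intros uc vc fc) auto
    fix t assume t: "t \<in> ?I - N"
    then obtain u' v' where d: "v t = of_real (f t) * u'" "(v has_vector_derivative v') (at t)"
      "\<i> * of_real \<epsilon> * v' + \<i> * u' = lam * u t" using eq[OF t] by blast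
    have "of_real \<epsilon> * v' = - \<i> * (\<i> * of_real \<epsilon> * v')" by (simp flip: mult.assoc)
    also have "\<dots> = - \<i> * (lam * u t) - u'" unfolding d(3)[symmetric] by (simp add: algebra_simps)
    finally have "v' = (- \<i> * lam * u t - u') / of_real \<epsilon>" using eps by (simp add: field_simps)
    then show "(v has_vector_derivative (- \<i> * lam * u t - v t / of_real (f t)) / of_real \<epsilon>) (at t)"
      using d nz[of t] t by auto
  qed
  show ?thesis by (rule that[OF du dv])
qed

theorem theorem3p7:
  fixes f :: "real \<Rightarrow> real" and \<epsilon> :: real
  assumes "0 < \<epsilon>" and "\<epsilon> < pi / 2"
    and "continuous_on UNIV f"
    and "\<And>x. f (x + 2 * pi) = f x"
    and "\<And>x. f (x + pi) = - f x"
    and "\<And>x. f (- x) = - f x"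
    and "\<And>x. x \<in> {0<..<pi} \<Longrightarrow> f x > 0"
    and "finite {x \<in> {-pi..<pi}. \<not> f differentiable (at x)}"
    and "\<And>k::int. f differentiable (at (of_int k * pi))"
    and "(f has_real_derivative 2 / pi) (at 0)"
    and "deriv f differentiable (at 0)"
    and "deriv f differentiable (at pi)"
  shows "\<forall>lam::complex. periodic_eigenvalue f \<epsilon> lam \<longrightarrow> lam \<in> \<real>"
proof (intro allI impI)
  fix lam assume "periodic_eigenvalue f \<epsilon> lam"
  then obtain u l where sol: "ode_solution f \<epsilon> lam u" and nonzero: "\<exists>x\<in>{-pi<..<pi}. u x \<noteq> 0"
    and lim: "(u \<longlongrightarrow> l) (at_right (-pi))" "(u \<longlongrightarrow> l) (at_left pi)"
    unfolding periodic_eigenvalue_def by blast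
  note eps = assms(1) and pos = assms(7) and odd = assms(6)
  obtain c F where c: "c > 0" "\<And>x. x \<in> {0<..<pi} \<Longrightarrow> c * min x (pi - x) \<le> f x"
    and F: "\<And>x. x \<in> {0<..<pi} \<Longrightarrow> f x \<le> F" "\<And>x. x \<in> {0<..<pi} \<Longrightarrow> f x \<le> F * x"
    using odd_antiperiodic_bounds[OF assms(3,5,6,7,10)] by auto
  \<comment> \<open>The upper bound on \<open>\<epsilon>\<close> leaves room for a slope
    \<open>d\<close> above that of \<open>f\<close> at 0 with
    \<open>d * \<epsilon> < 1\<close>.\<close>
  have "2 / pi < 1 / \<epsilon>" using assms(1,2) by (simp add: field_simps)
  then obtain d where d: "2 / pi < d" "d < 1 / \<epsilon>" using dense by blast
  then have d': "d > 0" "d * \<epsilon> < 1" using eps order.strict_trans[of 0 "2 / pi" d] by (auto simp: field_simps)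
  have f0: "f 0 = 0" using odd[of 0] by simp
  have "((\<lambda>x. f x / x) \<longlongrightarrow> 2 / pi) (at_right 0)"
    using assms(10) f0 by (auto simp: has_field_derivative_iff intro: filterlim_at_split[THEN iffD1, THEN conjunct2])
  then have "\<forall>\<^sub>F x in at_right 0. f x / x < d" using d(1) by (rule order_tendstoD)
  then obtain \<delta> where \<delta>: "\<delta> > 0" "\<And>x. 0 < x \<Longrightarrow> x < \<delta> \<Longrightarrow> f x / x < d"
    by (auto simp: eventually_at_right_field)
  \<comment> \<open>The slope bound near 0 is reflected to \<open>pi\<close>;
    \<open>\<delta> / 2\<close> keeps \<open>pi - x\<close> strictly below
    \<open>\<delta>\<close>.\<close>
  define b where "b = max (pi / 2) (pi - \<delta> / 2)"
  have b: "pi / 2 \<le> b" "b < pi" using \<delta>(1) by (auto simp: b_def)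
  have "f x \<le> d * (pi - x)" if x: "x \<in> {b..<pi}" for x
  proof -
    have "f x = f (pi - x)" using assms(5)[of "- x"] odd[of x] by (simp add: add.commute)
    moreover have "0 < pi - x" "pi - x < \<delta>" using x \<delta>(1) by (auto simp: b_def)
    ultimately show ?thesis using \<delta>(2)[of "pi - x"] by (simp add: field_simps)
  qed
  then obtain P R M where "singular_ode f P R \<epsilon> M F c"
    using singular_ode_exists[OF eps continuous_on_subset[OF assms(3)] pos F c b d'] by blast
  then interpret singular_ode f P R \<epsilon> M F c .
  define z where "z = - \<i> * lam"
  have nz: "f x \<noteq> 0" if "x \<in> {-pi<..<0} \<union> {0<..<pi}" for x
    using that pos[of x] pos[of "-x"] odd[of x] by auto
  obtain v where
    du: "\<And>x. x \<in> {-pi<..<0} \<union> {0<..<pi} \<Longrightarrow> (u has_vector_derivative v x / of_real (f x)) (at x)" and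
    dv: "\<And>x. x \<in> {-pi<..<0} \<union> {0<..<pi} \<Longrightarrow>
      (v has_vector_derivative (z * u x - v x / of_real (f x)) / of_real \<epsilon>) (at x)"
    using ode_solution_classical[OF sol eps assms(3) nz] unfolding z_def by metis
  have u0: "(u \<longlongrightarrow> u 0) (at 0)" using sol by (simp add: ode_solution_def isCont_def)
  have u0r: "(u \<longlongrightarrow> u 0) (at_right 0)" and u0l: "(u \<longlongrightarrow> u 0) (at_left 0)"
    using u0 by (auto simp: filterlim_at_split)
  \<comment> \<open>\<open>?Y\<close> carries no minus sign: the one from the chain rule cancels
    against \<open>f (- x) = - f x\<close>. In the second equation only the sign of \<open>z\<close>
    changes.\<close>
  let ?y = "\<lambda>x. u (- x)" and ?Y = "\<lambda>x. v (- x)"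
  have y_lim: "(?y \<longlongrightarrow> u 0) (at_right 0)"
    using u0l filterlim_at_left_to_right[of u "nhds (u 0)" 0] by simp
  have y_lim': "(?y \<longlongrightarrow> l) (at_left pi)"
    using lim(1) unfolding filterlim_def at_right_minus[of "-pi"] by (simp add: filtermap_filtermap)
  have neg: "((\<lambda>x::real. - x) has_vector_derivative -1) (at x)" for x
    by (auto intro!: derivative_eq_intros)
  have dy: "(?y has_vector_derivative ?Y x / of_real (f x)) (at x)" if x: "x \<in> {0<..<pi}" for x
    using vector_diff_chain_at[OF neg du[of "- x"]] x odd[of x] by (simp add: o_def)
  have dY: "(?Y has_vector_derivative ((- z) * ?y x - ?Y x / of_real (f x)) / of_real \<epsilon>) (at x)"
    if x: "x \<in> {0<..<pi}" for x
  proof -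
    have "- 1 *\<^sub>R ((z * ?y x - ?Y x / of_real (f (- x))) / of_real \<epsilon>) = ((- z) * ?y x - ?Y x / of_real (f x)) / of_real \<epsilon>"
      by (simp add: odd diff_divide_distrib add_divide_distrib)
    then show ?thesis
      using vector_diff_chain_at[OF neg dv[of "- x"]] x by (simp only: o_def) auto
  qed
  have right: "l = u 0 * G z"
    by (rule solution_limit_eq[OF du dv u0r lim(2)]) auto
  have left: "l = u 0 * G (- z)"
    by (rule solution_limit_eq[OF dy dY y_lim y_lim'])
  \<comment> \<open>A solution vanishing at 0 vanishes on both halves by uniqueness. With
    \<open>u 0\<close> nonzero it can be cancelled from the two expressions for
    \<open>l\<close>.\<close>
  have "u 0 \<noteq> 0"
  proof
    assume zero: "u 0 = 0"
    obtain x where x: "x \<in> {-pi<..<pi}" "u x \<noteq> 0" using nonzero by blast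
    have "u t = 0" "u (- t) = 0" if t: "t \<in> {0<..<pi}" for t
      using solution_eq_0[OF du dv u0r lim(2) zero t] solution_eq_0[OF dy dY y_lim y_lim' zero t] by auto
    from this[of x] this[of "- x"] zero x show False by (cases x "0::real" rule: linorder_cases) auto
  qed
  then have "Re z = 0" using left right imaginary_if_G_even by simp
  \<comment> \<open>\<open>Re z\<close> equals \<open>Im lam\<close>.\<close>
  then show "lam \<in> \<real>" by (simp add: z_def complex_is_Real_iff)
qed

end
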